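(* The problem PPT (defined in the context) is decidable for correlation-free cellular automata (CFCA) of dimension $1$ when the threshold function $\vartheta$ satisfies $\vartheta(n)=\alpha\lambda^n$ for some $\alpha>0$ and $\lambda<1$, which may depend on the CFCA.
   Context: A (one-dimensional) stochastic cellular automaton (CA) is a tuple $(Q,R,V,V',f)$ where $Q$ (states) and $R$ (random symbols) are finite sets, $V=\{v_1,\dots,v_\rho\}$ and $V'=\{v'_1,\dots,v'_{\rho'}\}$ are finite subsets of $\mathbb{Z}$, and $f:Q^\rho\times R^{\rho'}\to Q$. It is a correlation-free CA (CFCA) if $V'=\{0\}$. It is identified with its explicit global function $F:Q^{\mathbb{Z}}\times R^{\mathbb{Z}}\to Q^{\mathbb{Z}}$, $F(c,s)_z=f\big((c_{z+v_j})_j,(s_{z+v'_j})_j\big)$. For $c\in Q^{\mathbb{Z}}$, $\mathcal{S}_F(c)$ is the law of $F(c,s)$ when $s$ is drawn from the uniform (i.i.d. uniform product) measure on $R^{\mathbb{Z}}$. For a finite word $u$ with letters $u_0,\dots,u_{|u|-1}$ and $z\in\mathbb{Z}$, $[u]_z=\{c: c_{z+x}=u_x \text{ for all } 0\le x<|u|\}$. Problem PPT (Pattern Probability Threshold). Input: a stochastic CA $F$ over a state set $Q$ with $|Q|\ge 4$, three distinguished distinct symbols $x,y,z\in Q$, and a threshold function $\vartheta:\mathbb{N}\to[0,1]$. Question: is there a configuration $c$ and $n\ge1$ such that $\big(\mathcal{S}_F(c)\big)([x\cdot y^n\cdot z]_0)>\vartheta(n)$? "PPT for CFCA" means that the input CA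 is restricted to be a CFCA.
   Formalization: The real parameters α and λ are given by finite names for which it is decidable whether a rational number exceeds λ^n or αλ^n; without such a condition the claim fails, e.g. for a fixed non-computable λ. *)

theory Defs
  imports "HOL-Probability.Probability" "HOL-Library.Nat_Bijection"
begin

section \<open>Stochastic cellular automata\<close>

text \<open>
  The neighbourhoods are listed as \<open>v\<^sub>1, \<dots>, v\<^sub>\<rho>\<close>, because the local rule takes its
  arguments in that order.  Only the values of \<^emph>\<open>local_rule\<close> on words of the right lengths
  over \<open>Q\<close> and \<open>R\<close> are meaningful.
\<close>

record ('q, 'r) stochastic_ca =
  states :: "'q set"
  symbols :: "'r set"
  nbhd :: "int list"
  random_nbhd :: "int list"
  local_rule :: "'q list \<Rightarrow> 'r list \<Rightarrow> 'q"

definition is_stochastic_ca :: "('q, 'r) stochastic_ca \<Rightarrow> bool" where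
  "is_stochastic_ca A \<longleftrightarrow>
     finite (states A) \<and> states A \<noteq> {} \<and>
     finite (symbols A) \<and> symbols A \<noteq> {} \<and>
     distinct (nbhd A) \<and> distinct (random_nbhd A) \<and>
     (\<forall>u w. length u = length (nbhd A) \<and> set u \<subseteq> states A \<and>
            length w = length (random_nbhd A) \<and> set w \<subseteq> symbols A \<longrightarrow>
            local_rule A u w \<in> states A)"

definition is_cfca :: "('q, 'r) stochastic_ca \<Rightarrow> bool" where
  "is_cfca A \<longleftrightarrow> is_stochastic_ca A \<and> set (random_nbhd A) = {0}"

definition configurations :: "('q, 'r) stochastic_ca \<Rightarrow> (int \<Rightarrow> 'q) set" where
  "configurations A = (UNIV \<rightarrow> states A)"

definition global_fun :: "('q, 'r) stochastic_ca \<Rightarrow> (int \<Rightarrow> 'q) \<Rightarrow> (int \<Rightarrow> 'r) \<Rightarrow> (int \<Rightarrow> 'q)" where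
  "global_fun A c s = (\<lambda>z. local_rule A (map (\<lambda>v. c (z + v)) (nbhd A))
                                        (map (\<lambda>v. s (z + v)) (random_nbhd A)))"

definition ca_law :: "('q, 'r) stochastic_ca \<Rightarrow> (int \<Rightarrow> 'q) \<Rightarrow> (int \<Rightarrow> 'q) measure" where
  "ca_law A c = distr (\<Pi>\<^sub>M i\<in>UNIV. uniform_count_measure (symbols A))
                      (\<Pi>\<^sub>M i\<in>UNIV. count_space (states A)) (global_fun A c)"

definition cylinder :: "('q, 'r) stochastic_ca \<Rightarrow> 'q list \<Rightarrow> int \<Rightarrow> (int \<Rightarrow> 'q) set" where
  "cylinder A u z = {c \<in> configurations A. \<forall>k < length u. c (z + int k) = u ! k}"

text \<open>The law is well defined: \<^term>\<open>distr\<close> is applied to a measurable map.\<close>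

lemma global_fun_measurable:
  assumes A: "is_stochastic_ca A" and c: "c \<in> configurations A"
  shows "global_fun A c \<in> measurable (\<Pi>\<^sub>M i\<in>UNIV. uniform_count_measure (symbols A))
                      (\<Pi>\<^sub>M i\<in>UNIV. count_space (states A))"
proof (rule measurable_PiM_single')
  let ?S = "\<Pi>\<^sub>M i\<in>(UNIV::int set). uniform_count_measure (symbols A)"
  show "global_fun A c \<in> space ?S \<rightarrow> UNIV \<rightarrow>\<^sub>E space (count_space (states A))"
  proof (rule funcsetI)
    fix s assume s: "s \<in> space ?S"
    have "global_fun A c s z \<in> states A" for z
    proof -
      have "set (map (\<lambda>v. c (z + v)) (nbhd A)) \<subseteq> states A"
        using c by (auto simp: configurations_def)
      moreover have "set (map (\<lambda>v. s (z + v)) (random_nbhd A)) \<subseteq> symbols A"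
        using s by (auto simp: space_PiM space_uniform_count_measure)
      ultimately show ?thesis
        using A unfolding is_stochastic_ca_def global_fun_def by (simp del: set_map)
    qed
    then show "global_fun A c s \<in> UNIV \<rightarrow>\<^sub>E space (count_space (states A))"
      by (auto simp: PiE_iff)
  qed
  fix z :: int
  let ?g = "\<lambda>s::int\<Rightarrow>_. map (\<lambda>v. s (z + v)) (random_nbhd A)"
  have fin: "finite {w. set w \<subseteq> symbols A \<and> length w = length (random_nbhd A)}" (is "finite ?W")
    using A by (intro finite_lists_length_eq) (auto simp: is_stochastic_ca_def)
  have comp: "(\<lambda>s. s i) \<in> measurable ?S (count_space (symbols A))" for i
    using measurable_component_singleton[of i UNIV "\<lambda>_. uniform_count_measure (symbols A)"]
    by (simp add: measurable_cong_sets[OF refl, of "uniform_count_measure (symbols A)"  "count_space (symbols A)"])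
  have "?g \<in> measurable ?S (count_space ?W)"
    apply (subst measurable_count_space_eq2[OF fin])
    apply safe
      apply (force simp: space_PiM space_uniform_count_measure)
     apply simp
  proof -
    fix w assume w: "set w \<subseteq> symbols A" "length w = length (random_nbhd A)"
    have "?g -` {w} \<inter> space ?S = {s \<in> space ?S. \<forall>j\<in>{..<length w}. s (z + random_nbhd A ! j) = w ! j}"
      using w by (auto simp: list_eq_iff_nth_eq)
    also have "\<dots> \<in> sets ?S"
    proof (intro sets.sets_Collect_finite_All)
      fix j assume "j \<in> {..<length w}"
      have "(\<lambda>s. s (z + random_nbhd A ! j)) -` {w!j} \<inter> space ?S \<in> sets ?S"
        using w \<open>j \<in> _\<close> by (intro measurable_sets[OF comp]) (auto simp: subset_iff)
      also have "(\<lambda>s. s (z + random_nbhd A ! j)) -` {w!j} \<inter> space ?S = {s \<in> space ?S. s (z + random_nbhd A ! j) = w ! j}" by auto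
      finally show "{s \<in> space ?S. s (z + random_nbhd A ! j) = w ! j} \<in> sets ?S" .
    qed auto
    finally show "?g -` {w} \<inter> space ?S \<in> sets ?S" .
  qed
  moreover have "(\<lambda>w. local_rule A (map (\<lambda>v. c (z + v)) (nbhd A)) w) \<in> measurable (count_space ?W) (count_space (states A))"
  proof -
    have "set (map (\<lambda>v. c (z + v)) (nbhd A)) \<subseteq> states A"
      using c by (auto simp: configurations_def)
    then show ?thesis using A by (simp add: is_stochastic_ca_def del: set_map)
  qed
  ultimately show "(\<lambda>s. global_fun A c s z) \<in> measurable ?S (count_space (states A))"
    unfolding global_fun_def by (rule measurable_compose)
qed

lemma prob_space_ca_law:
  assumes "is_stochastic_ca A" "c \<in> configurations A"
  shows "prob_space (ca_law A c)"
proof -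
  interpret prob_space "uniform_count_measure (symbols A)"
    using assms(1) by (intro prob_space_uniform_count_measure) (auto simp: is_stochastic_ca_def)
  interpret product_prob_space "\<lambda>_. uniform_count_measure (symbols A)" "UNIV::int set" ..
  show ?thesis unfolding ca_law_def
    by (intro prob_space_distr global_fun_measurable assms)
qed

lemma cylinder_in_sets: assumes "set u \<subseteq> states A" shows "cylinder A u z \<in> sets (ca_law A c)"
proof -
  let ?S = "\<Pi>\<^sub>M i\<in>(UNIV::int set). count_space (states A)"
  have "cylinder A u z = {c\<in>space ?S. \<forall>k\<in>{..<length u}. c (z+int k) = u ! k}"
    by (auto simp: cylinder_def configurations_def space_PiM PiE_iff)
  also have "\<dots> \<in> sets ?S"
  proof (intro sets.sets_Collect_finite_All)
    fix k assume "k \<in> {..<length u}"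
    have "(\<lambda>s. s (z + int k)) -` {u!k} \<inter> space ?S \<in> sets ?S"
      using assms \<open>k \<in> _\<close> by (intro measurable_sets[OF measurable_component_singleton]) (auto simp: subset_iff)
    also have "(\<lambda>s. s (z + int k)) -` {u!k} \<inter> space ?S = {s\<in>space ?S. s (z + int k) = u ! k}" by auto
    finally show "{s\<in>space ?S. s (z + int k) = u ! k} \<in> sets ?S" .
  qed auto
  finally show ?thesis by (simp add: ca_law_def)
qed

definition PPT_input :: "('q, 'r) stochastic_ca \<Rightarrow> 'q \<Rightarrow> 'q \<Rightarrow> 'q \<Rightarrow> bool" where
  "PPT_input A x y z \<longleftrightarrow>
     is_stochastic_ca A \<and> card (states A) \<ge> 4 \<and>
     x \<in> states A \<and> y \<in> states A \<and> z \<in> states A \<and> x \<noteq> y \<and> y \<noteq> z \<and> x \<noteq> z"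

definition PPT :: "('q, 'r) stochastic_ca \<Rightarrow> 'q \<Rightarrow> 'q \<Rightarrow> 'q \<Rightarrow> (nat \<Rightarrow> real) \<Rightarrow> bool" where
  "PPT A x y z \<theta> \<longleftrightarrow>
     (\<exists>c \<in> configurations A. \<exists>n \<ge> 1.
        measure (ca_law A c) (cylinder A ([x] @ replicate n y @ [z]) 0) > \<theta> n)"


section \<open>Decidability\<close>

text \<open>
  Kleene's total recursive functions of arity \<open>n\<close>, as functions on lists; only their values on
  lists of length \<open>n\<close> matter.  Minimisation is restricted to regular functions, so that exactly
  the total computable functions are obtained.
\<close>

inductive recursive_fn :: "nat \<Rightarrow> (nat list \<Rightarrow> nat) \<Rightarrow> bool" where
  zero: "recursive_fn n (\<lambda>xs. 0)"
| succ: "recursive_fn 1 (\<lambda>xs. Suc (xs ! 0))"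
| proj: "i < n \<Longrightarrow> recursive_fn n (\<lambda>xs. xs ! i)"
| comp: "recursive_fn (length gs) f \<Longrightarrow> (\<forall>g \<in> set gs. recursive_fn n g) \<Longrightarrow>
         recursive_fn n (\<lambda>xs. f (map (\<lambda>g. g xs) gs))"
| prim: "recursive_fn n f \<Longrightarrow> recursive_fn (n + 2) g \<Longrightarrow>
         recursive_fn (n + 1) (\<lambda>xs. rec_nat (f (tl xs)) (\<lambda>k r. g (k # r # tl xs)) (hd xs))"
| mini: "recursive_fn (n + 1) f \<Longrightarrow> (\<forall>xs. length xs = n \<longrightarrow> (\<exists>k. f (k # xs) = 0)) \<Longrightarrow>
         recursive_fn n (\<lambda>xs. LEAST k. f (k # xs) = 0)"

text \<open>
  The decision problem with set of inputs \<open>I\<close> (tuples of length \<open>k\<close>) and set of positive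
  instances \<open>Y\<close>: one algorithm has to answer correctly on every legal input.
\<close>

definition decidable_problem :: "nat \<Rightarrow> nat list set \<Rightarrow> nat list set \<Rightarrow> bool" where
  "decidable_problem k I Y \<longleftrightarrow>
     (\<exists>f. recursive_fn k f \<and> (\<forall>xs \<in> I. length xs = k \<and> f xs = (if xs \<in> Y then 1 else 0)))"

text \<open>
  As an input of an algorithm, an automaton is given by the lists of its states, of its random
  symbols and of its neighbourhoods, and by the table of its local rule.
\<close>

definition encode_ca :: "(nat, nat) stochastic_ca \<Rightarrow> nat" where
  "encode_ca A =
     (let qs = sorted_list_of_set (states A);
          rs = sorted_list_of_set (symbols A)
      in list_encode
           [list_encode qs, list_encode rs,
            list_encode (map int_encode (nbhd A)),
            list_encode (map int_encode (random_nbhd A)),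
            list_encode [local_rule A u w. u \<leftarrow> List.n_lists (length (nbhd A)) qs,
                                           w \<leftarrow> List.n_lists (length (random_nbhd A)) rs]])"

text \<open>
  Real parameters \<open>\<alpha>\<close>, \<open>\<lambda>\<close> reach an algorithm through names \<open>e \<in> N\<close> standing for the threshold
  \<open>n \<mapsto> \<alpha> e \<cdot> \<lambda> e ^ n\<close>.  The presentation is effective if it can be decided whether a given
  rational number \<open>p / q\<close> exceeds \<open>\<lambda> e ^ n\<close> (case \<open>i = 0\<close>), or \<open>\<alpha> e \<cdot> \<lambda> e ^ n\<close> (case \<open>i = 1\<close>).
  Without such a condition a single real \<open>\<lambda>\<close> could carry a non-computable amount of
  information, and PPT would be undecidable already for a single fixed threshold.
\<close>

definition effective_thresholds :: "nat set \<Rightarrow> (nat \<Rightarrow> real) \<Rightarrow> (nat \<Rightarrow> real) \<Rightarrow> bool" where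
  "effective_thresholds N \<alpha> lam \<longleftrightarrow>
     decidable_problem 5
       {[e, i, n, p, q] | e i n p q. e \<in> N \<and> i \<le> 1 \<and> q > 0}
       {[e, i, n, p, q] | e i n p q. real p / real q > \<alpha> e ^ i * lam e ^ n}"


section \<open>Rational parameters form an effective presentation\<close>

text \<open>
  Recursiveness up to agreement on lists of the right length, which is more convenient for
  closure properties.
\<close>

definition tot_rec :: "nat \<Rightarrow> (nat list \<Rightarrow> nat) \<Rightarrow> bool" where
  "tot_rec n f \<longleftrightarrow> (\<exists>g. recursive_fn n g \<and> (\<forall>xs. length xs = n \<longrightarrow> f xs = g xs))"

lemma rec_comp:
  assumes "tot_rec (length gs) f" "\<forall>g\<in>set gs. tot_rec n g"
  shows "tot_rec n (\<lambda>xs. f (map (\<lambda>g. g xs) gs))"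
proof -
  obtain f' where f': "recursive_fn (length gs) f'" "\<forall>xs. length xs = length gs \<longrightarrow> f xs = f' xs"
    using assms(1) by (auto simp: tot_rec_def)
  obtain h where h: "\<forall>g\<in>set gs. recursive_fn n (h g) \<and> (\<forall>xs. length xs = n \<longrightarrow> g xs = h g xs)"
    using assms(2) unfolding tot_rec_def by metis
  have "recursive_fn n (\<lambda>xs. f' (map (\<lambda>g. g xs) (map h gs)))"
    using f' h by (intro recursive_fn.comp) auto
  moreover have "f (map (\<lambda>g. g xs) gs) = f' (map (\<lambda>g. g xs) (map h gs))" if "length xs = n" for xs
  proof -
    have "map (\<lambda>g. g xs) gs = map (\<lambda>g. g xs) (map h gs)" using h that by auto
    then show ?thesis using f'(2) by (metis length_map)
  qed
  ultimately show ?thesis unfolding tot_rec_def by blast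
qed

lemma rec_comp1: "tot_rec 1 (\<lambda>xs. f (xs!0)) \<Longrightarrow> tot_rec n a \<Longrightarrow> tot_rec n (\<lambda>xs. f (a xs))"
  using rec_comp[of "[a]" "\<lambda>xs. f (xs!0)" n] by simp
lemma rec_comp2: "tot_rec 2 (\<lambda>xs. f (xs!0) (xs!1)) \<Longrightarrow> tot_rec n a \<Longrightarrow> tot_rec n b \<Longrightarrow> tot_rec n (\<lambda>xs. f (a xs) (b xs))"
  using rec_comp[of "[a,b]" "\<lambda>xs. f (xs!0) (xs!1)" n] by (simp add: numeral_2_eq_2)
lemma rec_proj: "i < n \<Longrightarrow> tot_rec n (\<lambda>xs. xs!i)"
  unfolding tot_rec_def using proj by blast
lemma rec_Suc: "tot_rec n a \<Longrightarrow> tot_rec n (\<lambda>xs. Suc (a xs))"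
  by (rule rec_comp1) (use succ in \<open>auto simp: tot_rec_def\<close>)
lemma rec_const: "tot_rec n (\<lambda>xs. k)"
  by (induction k) (use zero in \<open>auto simp: tot_rec_def intro: rec_Suc[unfolded tot_rec_def]\<close>)

lemma rec_prim2:
  assumes "tot_rec 1 (\<lambda>xs. f (xs!0))" "tot_rec 3 (\<lambda>xs. g (xs!0) (xs!1) (xs!2))"
  shows "tot_rec 2 (\<lambda>xs. rec_nat (f (xs!1)) (\<lambda>k r. g k r (xs!1)) (xs!0))"
proof -
  obtain f' where f': "recursive_fn 1 f'" "\<And>xs. length xs = 1 \<Longrightarrow> f (xs!0) = f' xs"
    using assms(1) by (auto simp: tot_rec_def)
  obtain g' where g': "recursive_fn 3 g'" "\<And>xs. length xs = 3 \<Longrightarrow> g (xs!0) (xs!1) (xs!2) = g' xs"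
    using assms(2) by (auto simp: tot_rec_def)
  have "recursive_fn (1+1) (\<lambda>xs. rec_nat (f' (tl xs)) (\<lambda>k r. g' (k # r # tl xs)) (hd xs))"
    by (rule prim) (use f' g' in \<open>simp_all add: numeral_3_eq_3 numeral_2_eq_2\<close>)
  moreover have "rec_nat (f (xs!1)) (\<lambda>k r. g k r (xs!1)) (xs!0) = rec_nat (f' (tl xs)) (\<lambda>k r. g' (k # r # tl xs)) (hd xs)" 
    if "length xs = 2" for xs
  proof -
    obtain a b where xs: "xs = [a,b]" using \<open>length xs = 2\<close>
      by (auto simp: numeral_2_eq_2 length_Suc_conv)
    have "g k r b = g' [k,r,b]" for k r using g'(2)[of "[k,r,b]"] by simp
    then show ?thesis using f'(2)[of "[b]"] xs by simp
  qed
  ultimately show ?thesis unfolding tot_rec_def one_add_one by blast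
qed

lemma rec_add: "tot_rec n a \<Longrightarrow> tot_rec n b \<Longrightarrow> tot_rec n (\<lambda>xs. a xs + b xs)"
proof (rule rec_comp2[of "(+)"])
  have eq: "rec_nat b (\<lambda>k r. Suc r) a = a + b" for a b by (induction a) auto
  show "tot_rec 2 (\<lambda>xs. xs!0 + xs!1)"
    using rec_prim2[of "\<lambda>x. x" "\<lambda>k r x. Suc r"] by (simp add: eq rec_proj rec_Suc)
qed
lemma rec_mult: "tot_rec n a \<Longrightarrow> tot_rec n b \<Longrightarrow> tot_rec n (\<lambda>xs. a xs * b xs)"
proof (rule rec_comp2[of "(*)"])
  have eq: "rec_nat 0 (\<lambda>k r. r + b) a = a * b" for a b :: nat by (induction a) auto
  show "tot_rec 2 (\<lambda>xs. xs!0 * xs!1)"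
    using rec_prim2[of "\<lambda>x. 0" "\<lambda>k r x. r + x"] by (simp add: eq rec_proj rec_Suc rec_add rec_const)
qed
lemma rec_pow: "tot_rec n a \<Longrightarrow> tot_rec n b \<Longrightarrow> tot_rec n (\<lambda>xs. a xs ^ b xs)"
proof (rule rec_comp2[of "\<lambda>b a. a ^ b"])
  have eq: "rec_nat (Suc 0) (\<lambda>k r. r * b) a = b ^ a" for a b :: nat by (induction a) auto
  show "tot_rec 2 (\<lambda>xs. xs!1 ^ xs!0)"
    using rec_prim2[of "\<lambda>x. Suc 0" "\<lambda>k r x. r * x"] by (simp add: eq rec_proj rec_Suc rec_mult rec_const)
qed
lemma rec_pred: "tot_rec n a \<Longrightarrow> tot_rec n (\<lambda>xs. a xs - 1)"
proof -
  assume a: "tot_rec n a"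
  have eq: "rec_nat 0 (\<lambda>k r. k) a = a - 1" for a :: nat by (cases a) auto
  have "tot_rec 2 (\<lambda>xs. xs!0 - 1)"
    using rec_prim2[of "\<lambda>x. 0" "\<lambda>k r x. k"] by (simp add: eq rec_proj rec_const)
  from rec_comp2[OF this a a] show ?thesis .
qed
lemma rec_diff: "tot_rec n a \<Longrightarrow> tot_rec n b \<Longrightarrow> tot_rec n (\<lambda>xs. a xs - b xs)"
proof (rule rec_comp2[of "\<lambda>b a. a - b"])
  have eq: "rec_nat b (\<lambda>k r. r - Suc 0) a = b - a" for a b :: nat by (induction a) auto
  show "tot_rec 2 (\<lambda>xs. xs!1 - xs!0)"
    using rec_prim2[of "\<lambda>x. x" "\<lambda>k r x. r - 1"] by (simp add: eq rec_proj rec_pred[simplified])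
qed
lemma rec_mu1:
  assumes "tot_rec 2 (\<lambda>xs. f (xs!0) (xs!1))" "\<And>x. \<exists>k. f k x = 0" "tot_rec n a"
  shows "tot_rec n (\<lambda>xs. LEAST k. f k (a xs) = 0)"
proof (rule rec_comp1[of "\<lambda>x. LEAST k. f k x = 0", OF _ assms(3)])
  obtain f' where f': "recursive_fn 2 f'" "\<And>xs. length xs = 2 \<Longrightarrow> f (xs!0) (xs!1) = f' xs"
    using assms(1) by (auto simp: tot_rec_def)
  have e: "f' [k, x] = f k x" for k x using f'(2)[of "[k,x]"] by simp
  have "recursive_fn 1 (\<lambda>xs. LEAST k. f' (k # xs) = 0)"
    by (rule mini) (use f' assms(2) in \<open>auto simp: e length_Suc_conv numeral_2_eq_2\<close>)
  then show "tot_rec 1 (\<lambda>xs. LEAST k. f k (xs!0) = 0)"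
    unfolding tot_rec_def by (auto simp: length_Suc_conv e intro!: exI)
qed

definition cantor_diag :: "nat \<Rightarrow> nat" where "cantor_diag e = (LEAST w. (Suc e) * 2 - (Suc w) * (w + 2) = 0)"
lemma rec_cantor_diag: "tot_rec n a \<Longrightarrow> tot_rec n (\<lambda>xs. cantor_diag (a xs))"
  unfolding cantor_diag_def 
proof (rule rec_mu1[of "\<lambda>k x. Suc x * 2 - Suc k * (k+2)"])
  show "\<exists>k. Suc x * 2 - Suc k * (k + 2) = 0" for x by (rule exI[of _ x]) simp
qed (intro rec_diff rec_mult rec_Suc rec_add rec_const rec_proj; simp)+
lemma cantor_diag: "cantor_diag (prod_encode (a, b)) = a + b"
  unfolding cantor_diag_def
proof (rule Least_equality)
  have t: "triangle n * 2 = n * Suc n" for n by (simp add: triangle_def)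
  show "Suc (prod_encode (a, b)) * 2 - Suc (a + b) * (a + b + 2) = 0"
    using t[of "a+b"] by (auto simp: prod_encode_def algebra_simps)
  fix y assume *: "Suc (prod_encode (a, b)) * 2 - Suc y * (y + 2) = 0"
  show "a + b \<le> y"
  proof (rule ccontr)
    assume "\<not> a + b \<le> y"
    then have "Suc y \<le> a + b" by simp
    then have "Suc y * (y + 2) \<le> (a+b) * Suc (a+b)" by (intro mult_mono) auto
    with * t[of "a+b"] show False by (simp add: prod_encode_def)
  qed
qed
definition "pfst e = e - triangle (cantor_diag e)"
definition "psnd e = cantor_diag e - pfst e"
lemma rec_triangle: assumes "tot_rec n a" shows "tot_rec n (\<lambda>xs. triangle (a xs))"
proof -
  have eq: "rec_nat 0 (\<lambda>k r. r + Suc k) a = triangle a" for a :: nat by (induction a) auto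
  have "tot_rec 2 (\<lambda>xs. triangle (xs!0))"
    using rec_prim2[of "\<lambda>x. 0" "\<lambda>k r x. r + Suc k"] by (simp add: eq rec_proj rec_const rec_add rec_Suc del: add_Suc_right)
  from rec_comp2[OF this assms assms] show ?thesis .
qed
lemma rec_pfst: "tot_rec n a \<Longrightarrow> tot_rec n (\<lambda>xs. pfst (a xs))"
  unfolding pfst_def by (intro rec_diff rec_triangle rec_cantor_diag)
lemma rec_psnd: "tot_rec n a \<Longrightarrow> tot_rec n (\<lambda>xs. psnd (a xs))"
  unfolding psnd_def by (intro rec_diff rec_pfst rec_cantor_diag)
lemma pfst [simp]: "pfst (prod_encode (a,b)) = a" by (simp add: pfst_def cantor_diag) (simp add: prod_encode_def)
lemma psnd [simp]: "psnd (prod_encode (a,b)) = b" by (simp add: psnd_def cantor_diag)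

text \<open>
  Names \<open>((a, b), (c, d))\<close> for \<open>\<alpha> = a / b\<close> and \<open>\<lambda> = c / d\<close>; \<^term>\<open>prod_encode\<close> is Cantor pairing.
\<close>

lemma rational_thresholds_effective:
  fixes num den :: "nat \<Rightarrow> nat"
  defines "N \<equiv> {prod_encode (prod_encode (a, b), prod_encode (c, d)) | a b c d. b > 0 \<and> d > 0}"
  shows "effective_thresholds N
     (\<lambda>e. let (r, s) = prod_decode e; (a, b) = prod_decode r in real a / real b)
     (\<lambda>e. let (r, s) = prod_decode e; (c, d) = prod_decode s in real c / real d)"
proof -
  let ?f = "\<lambda>xs::nat list. let e = xs!0; i = xs!1; n = xs!2; p = xs!3; q = xs!4 in
     1 - (1 - (p * psnd (pfst e) ^ i * psnd (psnd e) ^ n - q * pfst (pfst e) ^ i * pfst (psnd e) ^ n))"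
  have "tot_rec 5 ?f" unfolding Let_def
    by (intro rec_diff rec_mult rec_pow rec_pfst rec_psnd rec_const rec_proj) auto
  then obtain f where f: "recursive_fn 5 f" "\<And>xs. length xs = 5 \<Longrightarrow> ?f xs = f xs"
    unfolding tot_rec_def by blast
  show ?thesis
    unfolding effective_thresholds_def decidable_problem_def
  proof (rule exI[of _ f], intro conjI f ballI)
    fix xs
    assume "xs \<in> {[e, i, n, p, q] |e i n p q. e \<in> N \<and> i \<le> 1 \<and> 0 < q}"
    then obtain a b c d e i n p q where xs: "xs = [e,i,n,p,q]" and q: "q > 0" 
      and e: "e = prod_encode (prod_encode (a, b), prod_encode (c, d))" and b: "b > 0" "d > 0" 
      unfolding N_def by blast
    show len: "length xs = 5" by (simp add: xs)
    have "real p / real q > (real a / real b)^i * (real c / real d)^n \<longleftrightarrow>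
       real (p * b ^ i * d ^ n) > real (q * a ^ i * c ^ n)"
      using q b by (simp add: field_simps power_divide)
    then show "f xs = (if xs \<in> {[e, i, n, p, q] |e i n p q.
             (let (r, s) = prod_decode e; (a, b) = prod_decode r in real a / real b) ^ i * 
             (let (r, s) = prod_decode e; (c, d) = prod_decode s in real c / real d) ^ n
             < real p / real q} then 1 else 0)"
      unfolding f(2)[OF len, symmetric] unfolding of_nat_less_iff by (auto simp: xs e)
  qed
qed

end

theory Submission
  imports Defs
begin

text \<open>
  Given the configuration, the cells of a CFCA are updated independently, so the probability of
  \<open>x y\<^sup>n z\<close> is a product of local probabilities along a walk in the de Bruijn graph of windows.
  If such a walk of positive weight contains a closed walk of length \<open>l\<close> whose weight exceeds
  \<open>\<lambda>\<^sup>l\<close>, repeating it beats every threshold \<open>\<alpha> \<lambda>\<^sup>n\<close>.  If there is no such closed walk, cutting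
  closed walks out never decreases the quotient of the weight by \<open>\<lambda>\<^sup>n\<close>.  In both cases walks of
  length at most three times the number of windows suffice, and only finitely many comparisons
  of rational numbers with \<open>\<lambda>\<^sup>l\<close> and \<open>\<alpha> \<lambda>\<^sup>n\<close> remain.
\<close>

section \<open>Recursive functions of one packed argument\<close>

text \<open>
  All variables in scope are packed into one argument by Cantor pairing, so that a binder becomes
  an application of \<^const>\<open>pfst\<close> and \<^const>\<open>psnd\<close> and recursiveness is proved by following
  the syntax of a term.
\<close>

definition rc :: "(nat \<Rightarrow> nat) \<Rightarrow> bool" where
  "rc f \<longleftrightarrow> tot_rec 1 (\<lambda>xs. f (xs ! 0))"

definition rcp :: "(nat \<Rightarrow> bool) \<Rightarrow> bool" where
  "rcp P \<longleftrightarrow> rc (\<lambda>e. of_bool (P e))"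

lemma rec_prod_encode:
  "tot_rec n a \<Longrightarrow> tot_rec n b \<Longrightarrow> tot_rec n (\<lambda>xs. prod_encode (a xs, b xs))"
  unfolding prod_encode_def by (simp add: rec_add rec_triangle)

lemma rc_tot_rec: "rc f \<Longrightarrow> tot_rec n a \<Longrightarrow> tot_rec n (\<lambda>xs. f (a xs))"
  unfolding rc_def by (rule rec_comp1)

lemma rc_lift1: "rc f \<Longrightarrow> rc a \<Longrightarrow> rc (\<lambda>e. f (a e))"
  unfolding rc_def[of a] rc_def[of "\<lambda>e. f (a e)"] by (rule rc_tot_rec)

lemma rc_id: "rc (\<lambda>e. e)"
  unfolding rc_def by (rule rec_proj) simp

lemma rc_const: "rc (\<lambda>e. k)"
  unfolding rc_def by (rule rec_const)

lemma rc_Suc: "rc a \<Longrightarrow> rc (\<lambda>e. Suc (a e))"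
  unfolding rc_def by (rule rec_Suc)

lemma rc_add: "rc a \<Longrightarrow> rc b \<Longrightarrow> rc (\<lambda>e. a e + b e)"
  unfolding rc_def by (rule rec_add)

lemma rc_mult: "rc a \<Longrightarrow> rc b \<Longrightarrow> rc (\<lambda>e. a e * b e)"
  unfolding rc_def by (rule rec_mult)

lemma rc_pow: "rc a \<Longrightarrow> rc b \<Longrightarrow> rc (\<lambda>e. a e ^ b e)"
  unfolding rc_def by (rule rec_pow)

lemma rc_diff: "rc a \<Longrightarrow> rc b \<Longrightarrow> rc (\<lambda>e. a e - b e)"
  unfolding rc_def by (rule rec_diff)

lemma rc_pfst: "rc a \<Longrightarrow> rc (\<lambda>e. pfst (a e))"
  unfolding rc_def by (rule rec_pfst)

lemma rc_psnd: "rc a \<Longrightarrow> rc (\<lambda>e. psnd (a e))"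
  unfolding rc_def by (rule rec_psnd)

lemma rc_pair: "rc a \<Longrightarrow> rc b \<Longrightarrow> rc (\<lambda>e. prod_encode (a e, b e))"
  unfolding rc_def by (rule rec_prod_encode)

text \<open>Substitution: recursiveness at the two projections of one variable carries over to all
  recursive arguments. A definition then only has to be unfolded with variables as its
  arguments.\<close>

lemma rc_lift2:
  "rc (\<lambda>e. f (pfst e) (psnd e)) \<Longrightarrow> rc a \<Longrightarrow> rc b \<Longrightarrow> rc (\<lambda>e. f (a e) (b e))"
  using rc_lift1[OF _ rc_pair, of "\<lambda>e. f (pfst e) (psnd e)" a b] by simp

lemma rc_lift3:
  "rc (\<lambda>e. f (pfst e) (pfst (psnd e)) (psnd (psnd e))) \<Longrightarrow> rc a \<Longrightarrow> rc b \<Longrightarrow> rc c \<Longrightarrow>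
   rc (\<lambda>e. f (a e) (b e) (c e))"
  using rc_lift2[of "\<lambda>x y. f x (pfst y) (psnd y)", OF _ _ rc_pair] by simp

text \<open>The environment \<open>e\<close> is passed unchanged to every step as the last packed
  component; it also determines the start value and the number of steps.\<close>

lemma rc_prim:
  assumes "rc (\<lambda>p. g (pfst p) (pfst (psnd p)) (psnd (psnd p)))" "rc a" "rc b"
  shows "rc (\<lambda>e. rec_nat (a e) (\<lambda>k r. g k r e) (b e))"
proof -
  have "tot_rec 3 (\<lambda>xs. g (xs!0) (xs!1) (xs!2))"
    using rc_tot_rec[OF assms(1), of 3 "\<lambda>xs. prod_encode (xs!0, prod_encode (xs!1, xs!2))"]
    by (simp add: rec_prod_encode rec_proj)
  from rec_prim2[OF assms(2)[unfolded rc_def] this]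
  have "tot_rec 2 (\<lambda>xs. rec_nat (a (xs!1)) (\<lambda>k r. g k r (xs!1)) (xs!0))" .
  from rec_comp2[of "\<lambda>n x. rec_nat (a x) (\<lambda>k r. g k r x) n", OF this assms(3)[unfolded rc_def]]
  show ?thesis unfolding rc_def using rec_proj[of 0 1] by simp
qed

text \<open>Rule for a binder: under the sum, the index is the first component of the packed
  argument and the old environment the second.\<close>

lemma rc_sum:
  assumes "rc (\<lambda>p. g (pfst p) (psnd p))" "rc b"
  shows "rc (\<lambda>e. \<Sum>k<b e. g k e)"
proof -
  have "(\<Sum>k<n. g k e) = rec_nat 0 (\<lambda>k r. r + g k e) n" for n e
    by (induction n) auto
  moreover have "rc (\<lambda>e. rec_nat 0 (\<lambda>k r. r + g k e) (b e))"
    by (intro rc_prim rc_add rc_lift2[OF assms(1)] rc_pfst rc_psnd rc_id rc_const assms(2))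
  ultimately show ?thesis by simp
qed

lemma rc_prod:
  assumes "rc (\<lambda>p. g (pfst p) (psnd p))" "rc b"
  shows "rc (\<lambda>e. \<Prod>k<b e. g k e)"
proof -
  have "(\<Prod>k<n. g k e) = rec_nat 1 (\<lambda>k r. r * g k e) n" for n e
    by (induction n) auto
  moreover have "rc (\<lambda>e. rec_nat 1 (\<lambda>k r. r * g k e) (b e))"
    by (intro rc_prim rc_mult rc_lift2[OF assms(1)] rc_pfst rc_psnd rc_id rc_const assms(2))
  ultimately show ?thesis by simp
qed

section \<open>Decidable predicates, bounded quantifiers and division\<close>

lemma rcp_not: "rcp P \<Longrightarrow> rcp (\<lambda>e. \<not> P e)"
proof -
  assume "rcp P"
  then have "rc (\<lambda>e. 1 - of_bool (P e))"
    unfolding rcp_def by (intro rc_diff rc_const)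
  moreover have "of_bool (\<not> P e) = 1 - (of_bool (P e) :: nat)" for e by simp
  ultimately show ?thesis unfolding rcp_def by simp
qed

lemma rcp_conj: "rcp P \<Longrightarrow> rcp Q \<Longrightarrow> rcp (\<lambda>e. P e \<and> Q e)"
  unfolding rcp_def of_bool_conj by (rule rc_mult)

lemma rcp_disj: "rcp P \<Longrightarrow> rcp Q \<Longrightarrow> rcp (\<lambda>e. P e \<or> Q e)"
  using rcp_not[OF rcp_conj[OF rcp_not rcp_not]] by simp

text \<open>Truncated subtraction decides the order: \<open>1 - (a e - b e)\<close> is 1 or 0
  according to whether \<open>a e \<le> b e\<close>.\<close>

lemma rcp_le: "rc a \<Longrightarrow> rc b \<Longrightarrow> rcp (\<lambda>e. a e \<le> b e)"
proof -
  assume "rc a" "rc b"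
  then have "rc (\<lambda>e. 1 - (a e - b e))" by (intro rc_diff rc_const)
  moreover have "of_bool (a e \<le> b e) = 1 - (a e - b e)" for e by simp
  ultimately show ?thesis unfolding rcp_def by simp
qed

lemma rcp_less: "rc a \<Longrightarrow> rc b \<Longrightarrow> rcp (\<lambda>e. a e < b e)"
  unfolding not_le[symmetric] by (intro rcp_not rcp_le)

lemma rcp_eq: "rc a \<Longrightarrow> rc b \<Longrightarrow> rcp (\<lambda>e. a e = b e)"
  unfolding order_eq_iff by (intro rcp_conj rcp_le)

lemma rc_if: "rcp P \<Longrightarrow> rc a \<Longrightarrow> rc b \<Longrightarrow> rc (\<lambda>e. if P e then a e else b e)"
proof -
  assume "rcp P" "rc a" "rc b"
  then have "rc (\<lambda>e. of_bool (P e) * a e + (1 - of_bool (P e)) * b e)"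
    unfolding rcp_def by (intro rc_add rc_mult rc_diff rc_const)
  moreover have "(if P e then a e else b e) = of_bool (P e) * a e + (1 - of_bool (P e)) * b e" for e
    by simp
  ultimately show ?thesis by simp
qed

text \<open>A bounded existential is the positivity of a sum of indicators.\<close>

lemma rcp_ex:
  assumes "rcp (\<lambda>p. P (pfst p) (psnd p))" "rc b"
  shows "rcp (\<lambda>e. \<exists>k<b e. P k e)"
proof -
  have "(\<exists>k<n. P k e) \<longleftrightarrow> 0 < (\<Sum>k<n. of_bool (P k e) :: nat)" for n e
    by (auto simp: sum_pos2 simp del: sum_of_bool_eq intro: ccontr)
  moreover have "rcp (\<lambda>e. 0 < (\<Sum>k<b e. of_bool (P k e) :: nat))"
    by (intro rcp_less rc_const rc_sum assms[unfolded rcp_def])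
  ultimately show ?thesis by (simp only:)
qed

lemma rcp_all:
  assumes "rcp (\<lambda>p. P (pfst p) (psnd p))" "rc b"
  shows "rcp (\<lambda>e. \<forall>k<b e. P k e)"
  using rcp_not[OF rcp_ex[OF rcp_not, OF assms]] by simp

lemma rc_div: assumes "rc a" "rc b" shows "rc (\<lambda>e. a e div b e)"
proof (rule rc_lift2[OF _ assms])
  \<comment> \<open>The quotient counts the positive multiples of \<open>y\<close> up to
    \<open>x\<close>; the test \<open>0 < y\<close> yields the value 0 that HOL gives to division by
    0.\<close>
  have "x div y = (\<Sum>k<x. if 0 < y \<and> Suc k * y \<le> x then 1 else 0)" for x y :: nat
  proof (cases "y = 0")
    case False
    have "{k. k < x \<and> Suc k * y \<le> x} = {..<x div y}"
    proof (intro set_eqI, unfold mem_Collect_eq lessThan_iff)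
      fix k
      have "Suc k * y \<le> x \<longleftrightarrow> k < x div y"
        using False by (simp add: less_eq_div_iff_mult_less_eq Suc_le_eq[symmetric] del: mult_Suc)
      then show "k < x \<and> Suc k * y \<le> x \<longleftrightarrow> k < x div y"
        using div_le_dividend[of x y] by linarith
    qed
    moreover have "(\<Sum>k<x. if 0 < y \<and> Suc k * y \<le> x then 1 else 0) = card {k. k < x \<and> Suc k * y \<le> x}"
      using False by (simp add: sum.If_cases Int_def del: mult_Suc)
    ultimately show ?thesis by simp
  qed simp
  then show "rc (\<lambda>e. pfst e div psnd e)"
    by (simp only:) (intro rc_sum rc_if rcp_conj rcp_less rcp_le rc_mult rc_Suc rc_pfst rc_psnd rc_const rc_id)
qed

lemma rc_mod: "rc a \<Longrightarrow> rc b \<Longrightarrow> rc (\<lambda>e. a e mod b e)"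
  unfolding minus_mult_div_eq_mod[symmetric] by (intro rc_diff rc_mult rc_div)

lemmas rc_rules = rc_id rc_const rc_Suc rc_add rc_mult rc_pow rc_diff rc_pfst rc_psnd rc_sum rc_prod
  rc_if rc_div rc_mod rcp_not rcp_conj rcp_disj rcp_le rcp_less rcp_eq rcp_ex rcp_all

section \<open>Access to lists through their codes\<close>

definition code_drop :: "nat \<Rightarrow> nat \<Rightarrow> nat" where
  "code_drop l k = rec_nat l (\<lambda>_ r. psnd (r - 1)) k"

definition code_nth :: "nat \<Rightarrow> nat \<Rightarrow> nat" where
  "code_nth l k = pfst (code_drop l k - 1)"

text \<open>A list is no longer than its code, so counting the nonempty suffixes below the code
  counts all of them.\<close>

definition code_length :: "nat \<Rightarrow> nat" where
  "code_length l = (\<Sum>k<l. if code_drop l k = 0 then 0 else 1)"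

lemma rc_code_drop: "rc a \<Longrightarrow> rc b \<Longrightarrow> rc (\<lambda>e. code_drop (a e) (b e))"
  unfolding code_drop_def by (intro rc_prim rc_rules)

lemma rc_code_nth: "rc a \<Longrightarrow> rc b \<Longrightarrow> rc (\<lambda>e. code_nth (a e) (b e))"
  unfolding code_nth_def by (intro rc_code_drop rc_rules)

lemma rc_code_length: "rc a \<Longrightarrow> rc (\<lambda>e. code_length (a e))"
  by (rule rc_lift1) (unfold code_length_def, intro rc_code_drop rc_rules)

text \<open>A nonempty list has code \<open>Suc (prod_encode (x, list_encode xs))\<close>, so
  predecessor and second projection give the tail.\<close>

lemma code_drop: "code_drop (list_encode xs) k = list_encode (drop k xs)"
proof (induction k)
  case (Suc k)
  \<comment> \<open>Covers the empty list, whose code 0 stays 0.\<close>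
  have "psnd 0 = 0" using psnd[of 0 0] by (simp add: prod_encode_def)
  then have "psnd (list_encode ys - 1) = list_encode (tl ys)" for ys
    by (cases ys) simp_all
  with Suc show ?case
    by (simp add: code_drop_def tl_drop drop_Suc)
qed (simp add: code_drop_def)

lemma code_nth: "k < length xs \<Longrightarrow> code_nth (list_encode xs) k = xs ! k"
  by (simp add: code_nth_def code_drop Cons_nth_drop_Suc[symmetric])

lemma length_le_list_encode: "length xs \<le> list_encode xs"
  by (induction xs) (auto intro: order_trans[OF _ le_prod_encode_2])

text \<open>Bounds the codes of the neighbours by the code of their list, which makes the latter
  usable as a radius.\<close>

lemma member_le_list_encode: "x \<in> set xs \<Longrightarrow> x \<le> list_encode xs"
  by (induction xs) (auto intro: order_trans[OF _ le_prod_encode_2] le_SucI le_prod_encode_1)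

lemma code_length: "code_length (list_encode xs) = length xs"
proof -
  have "code_drop (list_encode xs) k = 0 \<longleftrightarrow> \<not> k < length xs" for k
    by (cases "drop k xs") (auto simp: code_drop dest: arg_cong[of _ _ length])
  moreover have "{k. k < list_encode xs \<and> k < length xs} = {..<length xs}"
    using length_le_list_encode[of xs] by auto
  ultimately show ?thesis
    by (simp add: code_length_def sum.If_cases Int_def)
qed

section \<open>Walks exceeding a threshold\<close>

lemma prod_list_map_nonneg: "(\<And>x. 0 \<le> f x) \<Longrightarrow> 0 \<le> prod_list (map f xs)"
  for f :: "'a \<Rightarrow> real"
  by (induction xs) auto

lemma prod_list_map_pos_iff:
  fixes f :: "'a \<Rightarrow> real"
  assumes "\<And>x. 0 \<le> f x"
  shows "0 < prod_list (map f xs) \<longleftrightarrow> (\<forall>x\<in>set xs. 0 < f x)"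
  using assms prod_list_map_nonneg[of f, OF assms]
  by (induction xs) (auto simp: zero_less_mult_iff order.strict_iff_order)

lemma prod_list_map_upt: "prod_list (map f [m..<n]) = (\<Prod>k\<in>{m..<n}. f k)"
  for f :: "nat \<Rightarrow> 'a::comm_monoid_mult"
  by (simp add: prod.distinct_set_conv_list[symmetric])

lemma successively_map_upt:
  "successively P (map v [m..<n]) \<longleftrightarrow> (\<forall>k. m \<le> k \<longrightarrow> Suc k < n \<longrightarrow> P (v k) (v (Suc k)))"
proof (induction n)
  case (Suc n)
  show ?case
  proof (cases "m < n")
    case True
    then obtain n' where "n = Suc n'" by (cases n) auto
    with True have "last (map v [m..<n]) = v (n - 1)" by (simp add: last_map)
    with True \<open>n = Suc n'\<close> show ?thesis using Suc.IH
      by (auto simp: successively_append_iff less_Suc_eq)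
  next
    case False
    then have "m = n \<or> n < m" by auto
    then show ?thesis by auto
  qed
qed simp

section \<open>Shortening and pumping walks\<close>

lemma successively_cut:
  "successively E (xs @ y # ys @ y # zs) \<Longrightarrow> successively E (xs @ y # zs)"
  by (auto simp: successively_append_iff successively_Cons)

text \<open>The segment cut out between two visits of \<open>y\<close> is itself closed: its last
  vertex steps back to \<open>y\<close>.\<close>

lemma last_hd_successively_cut:
  "successively E (xs @ y # ys @ y # zs) \<Longrightarrow> E (last (y # ys)) y"
  by (auto simp: successively_append_iff successively_Cons)

text \<open>The weights \<open>a\<close>, \<open>b\<close>, \<open>c\<close> will be the
  probabilities that a window produces the letters \<open>x\<close>, \<open>y\<close>,
  \<open>z\<close>, so the two ends of a walk are weighted differently from its inner
  vertices.\<close>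

locale threshold_walks =
  fixes V :: "'v set" and E :: "'v \<Rightarrow> 'v \<Rightarrow> bool" and a b c :: "'v \<Rightarrow> real" and \<alpha> lam :: real
  assumes finite_V: "finite V"
    and nonneg: "\<And>v. 0 \<le> a v" "\<And>v. 0 \<le> b v" "\<And>v. 0 \<le> c v" "0 \<le> \<alpha>" "0 \<le> lam"
begin

text \<open>The ends \<open>s\<close> and \<open>t\<close> stand apart because only inner vertices
  get cut out or repeated.\<close>

definition walk :: "'v \<Rightarrow> 'v list \<Rightarrow> 'v \<Rightarrow> bool" where
  "walk s vs t \<longleftrightarrow> set (s # vs @ [t]) \<subseteq> V \<and> successively E (s # vs @ [t])"

definition weight :: "'v \<Rightarrow> 'v list \<Rightarrow> 'v \<Rightarrow> real" where
  "weight s vs t = a s * prod_list (map b vs) * c t"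

definition gaining_cycle :: "'v list \<Rightarrow> bool" where
  "gaining_cycle B \<longleftrightarrow> B \<noteq> [] \<and> E (last B) (hd B) \<and> lam ^ length B < prod_list (map b B)"

definition pumpable :: "'v \<Rightarrow> 'v list \<Rightarrow> 'v list \<Rightarrow> 'v list \<Rightarrow> 'v \<Rightarrow> bool" where
  "pumpable s A B C t \<longleftrightarrow> walk s (A @ B @ C) t \<and> 0 < weight s (A @ B @ C) t \<and> gaining_cycle B"

lemma weight_pos_iff: "0 < weight s vs t \<longleftrightarrow> 0 < a s \<and> (\<forall>v\<in>set vs. 0 < b v) \<and> 0 < c t"
proof -
  have "0 < x * y \<longleftrightarrow> 0 < x \<and> 0 < y" if "0 \<le> x" "0 \<le> y" for x y :: real
    using that by (auto simp: zero_less_mult_iff)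
  then show ?thesis
    by (simp add: weight_def nonneg prod_list_map_nonneg prod_list_map_pos_iff)
qed

text \<open>Repetitions in \<open>A\<close> and \<open>C\<close> are cut out. A repetition in
  \<open>B\<close> splits it into two closed walks, at least one of which still gains. In the end
  all three segments are free of repetitions.\<close>

lemma short_pumpable:
  assumes "pumpable s A B C t"
  shows "\<exists>A' B' C'. pumpable s A' B' C' t \<and>
           length A' \<le> card V \<and> length B' \<le> card V \<and> length C' \<le> card V"
  using assms
\<comment> \<open>\<open>B\<close> counts twice, so that moving parts of it into \<open>A\<close>
  and \<open>C\<close> also decreases the measure.\<close>
proof (induction "length (A @ B @ C) + length B" arbitrary: A B C rule: less_induct)
  case less
  note P = less.prems[unfolded pumpable_def walk_def weight_pos_iff]
  consider xs y ys zs where "A = xs @ [y] @ ys @ [y] @ zs"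
    | xs y ys zs where "B = xs @ [y] @ ys @ [y] @ zs"
    | xs y ys zs where "C = xs @ [y] @ ys @ [y] @ zs"
    | "distinct A" "distinct B" "distinct C"
    using not_distinct_decomp by blast
  then show ?case
  proof cases
    case (1 xs y ys zs)
    have "pumpable s (xs @ [y] @ zs) B C t"
      using P successively_cut[of E "s # xs" y ys "zs @ B @ C @ [t]"]
      unfolding 1 pumpable_def walk_def weight_pos_iff by (simp add: ball_Un)
    then show ?thesis by (rule less.hyps[rotated]) (simp add: 1)
  next
    case (3 xs y ys zs)
    have "pumpable s A B (xs @ [y] @ zs) t"
      using P successively_cut[of E "s # A @ B @ xs" y ys "zs @ [t]"]
      unfolding 3 pumpable_def walk_def weight_pos_iff by (simp add: ball_Un)
    then show ?thesis by (rule less.hyps[rotated]) (simp add: 3)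
  next
    case (2 xs y ys zs)
    show ?thesis
    proof (cases "lam ^ length (y # ys) < prod_list (map b (y # ys))")
      case True
      \<comment> \<open>The inner loop gains: it becomes the new middle segment, while the walk as a
        whole is unchanged.\<close>
      have "pumpable s (A @ xs) (y # ys) (y # zs @ C) t"
        using P True last_hd_successively_cut[of E "s # A @ xs" y ys "zs @ C @ [t]"]
        unfolding 2 pumpable_def walk_def weight_pos_iff gaining_cycle_def by (simp add: ball_Un)
      then show ?thesis by (rule less.hyps[rotated]) (simp add: 2)
    next
      case False
      \<comment> \<open>The weights of the two loops multiply to that of \<open>B\<close>; as the
        inner loop does not gain, the outer one must.\<close>
      have "lam ^ length (xs @ [y] @ zs) < prod_list (map b (xs @ [y] @ zs))"
      proof (rule ccontr)
        assume "\<not> ?thesis"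
        then have "prod_list (map b (y # ys)) * prod_list (map b (xs @ [y] @ zs))
          \<le> lam ^ length (y # ys) * lam ^ length (xs @ [y] @ zs)"
          using False nonneg(5) by (intro mult_mono prod_list_map_nonneg nonneg) auto
        also have "\<dots> = lam ^ length B" unfolding power_add[symmetric] by (simp add: 2 ac_simps)
        also have "prod_list (map b (y # ys)) * prod_list (map b (xs @ [y] @ zs)) = prod_list (map b B)"
          by (simp add: 2 mult_ac)
        finally show False using P by (simp add: gaining_cycle_def)
      qed
      then have "gaining_cycle (xs @ [y] @ zs)"
        using P unfolding gaining_cycle_def 2 by (cases xs) auto
      then have "pumpable s A (xs @ [y] @ zs) C t"
        using P successively_cut[of E "s # A @ xs" y ys "zs @ C @ [t]"]
        unfolding 2 pumpable_def walk_def weight_pos_iff by (simp add: ball_Un)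
      then show ?thesis by (rule less.hyps[rotated]) (simp add: 2)
    qed
  next
    case 4
    have "length xs \<le> card V" if "distinct xs" "set xs \<subseteq> V" for xs
      using distinct_card[OF that(1)] card_mono[OF finite_V that(2)] by simp
    then have "length A \<le> card V" "length B \<le> card V" "length C \<le> card V"
      using P 4 by auto
    with less.prems show ?thesis by blast
  qed
qed

text \<open>Here every closed segment of a walk of positive weight weighs at most \<open>lam\<close>
  to the power of its length, so cutting it out leaves the threshold exceeded. This is repeated
  until the inner vertices are distinct.\<close>

lemma short_exceeding_walk:
  assumes "\<And>A B C. \<not> pumpable s A B C t"
    and "walk s vs t" "vs \<noteq> []" "\<alpha> * lam ^ length vs < weight s vs t"
  shows "\<exists>us. walk s us t \<and> us \<noteq> [] \<and> \<alpha> * lam ^ length us < weight s us t \<and> length us \<le> card V"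
  using assms(2-)
proof (induction vs rule: length_induct)
  case (1 vs)
  show ?case
  proof (cases "distinct vs")
    case True
    have "length vs \<le> card V"
      using distinct_card[OF True] card_mono[OF finite_V, of "set vs"] "1.prems"(1)
      by (simp add: walk_def)
    then show ?thesis using "1.prems" by blast
  next
    case False
    then obtain xs y ys zs where vs: "vs = xs @ [y] @ ys @ [y] @ zs"
      using not_distinct_decomp by blast
    let ?us = "xs @ [y] @ zs" and ?B = "y # ys"
    \<comment> \<open>Exceeding a nonnegative threshold forces positive weight, as
      \<open>pumpable\<close> demands.\<close>
    have "0 \<le> \<alpha> * lam ^ length vs" using nonneg by simp
    with "1.prems" have pos: "0 < weight s vs t" by linarith
    have "\<not> pumpable s xs ?B (y # zs) t" by (rule assms)
    then have le: "prod_list (map b ?B) \<le> lam ^ length ?B"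
      using "1.prems"(1) pos last_hd_successively_cut[of E "s # xs" y ys "zs @ [t]"]
      unfolding vs pumpable_def gaining_cycle_def walk_def by (simp add: not_less)
    have eq: "weight s vs t = prod_list (map b ?B) * weight s ?us t"
      by (simp add: weight_def vs mult_ac)
    have "\<alpha> * lam ^ length ?us < weight s ?us t"
    \<comment> \<open>Arguing by contradiction avoids division by a power of \<open>lam\<close>,
      which may be 0.\<close>
    proof (rule ccontr)
      assume "\<not> ?thesis"
      then have "weight s vs t \<le> lam ^ length ?B * (\<alpha> * lam ^ length ?us)"
        unfolding eq using le nonneg(5)
        by (intro mult_mono) (auto simp: weight_def intro!: mult_nonneg_nonneg prod_list_map_nonneg nonneg)
      also have "\<dots> = \<alpha> * lam ^ length vs" by (simp add: vs power_add)
      finally show False using "1.prems" by simp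
    qed
    moreover have "walk s ?us t"
      using "1.prems"(1) successively_cut[of E "s # xs" y ys "zs @ [t]"]
      unfolding vs walk_def by simp
    moreover have "length ?us < length vs" "?us \<noteq> []" by (simp_all add: vs)
    ultimately show ?thesis using "1.IH" by blast
  qed
qed

text \<open>Each further copy of \<open>B\<close> multiplies the weight by more than it multiplies
  the threshold, so the weight eventually wins whatever the factor \<alpha>.\<close>

lemma pump:
  assumes "pumpable s A B C t"
  shows "\<exists>vs. walk s vs t \<and> vs \<noteq> [] \<and> \<alpha> * lam ^ length vs < weight s vs t"
proof -
  note P = assms[unfolded pumpable_def]
  \<comment> \<open>One copy of \<open>B\<close> comes on top of the \<open>k\<close> repetitions,
    so \<open>?X 0\<close> is the given walk.\<close>
  let ?X = "\<lambda>k. A @ concat (replicate k B) @ B @ C"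
  have B: "B \<noteq> []" "E (last B) (hd B)" "lam ^ length B < prod_list (map b B)"
    using P by (auto simp: gaining_cycle_def)
  have walk: "walk s (?X k) t" for k
  proof (induction k)
    case (Suc k)
    \<comment> \<open>Commuting \<open>B\<close> with its copies shows that what follows
      \<open>A\<close> always starts with \<open>hd B\<close>.\<close>
    have "concat (replicate k B) @ B = B @ concat (replicate k B)"
      by (induction k) auto
    then have "hd (concat (replicate k B) @ B @ C) = hd B" "concat (replicate k B) @ B @ C \<noteq> []"
      using B by (metis append.assoc hd_append2) (use B in auto)
    moreover have "successively E B" using P by (auto simp: walk_def successively_Cons successively_append_iff)
    ultimately show ?case using Suc B
      unfolding walk_def successively_Cons
      by (auto simp: successively_append_iff hd_append)
  qed (use P in simp)
  let ?r = "prod_list (map b B)" and ?w = "weight s (A @ B @ C) t" and ?l = "length (A @ B @ C)"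
  have weight: "weight s (?X k) t = ?r ^ k * ?w" for k
    by (induction k) (auto simp: weight_def mult_ac)
  have len: "length (?X k) = length B * k + ?l" for k
    by (induction k) auto
  have w: "0 < ?w" using P by simp
  have r: "0 < ?r" using B(3) nonneg(5) by (meson order.strict_trans1 zero_le_power)
  have "\<exists>k. (lam ^ length B) ^ k * (\<alpha> * lam ^ ?l) < ?r ^ k * ?w"
  proof -
    \<comment> \<open>This ratio lies in [0, 1), so its powers tend to 0.\<close>
    let ?q = "lam ^ length B / ?r"
    have "(\<lambda>k. ?q ^ k * (\<alpha> * lam ^ ?l)) \<longlonglongrightarrow> 0 * (\<alpha> * lam ^ ?l)"
      using B(3) r nonneg(5) by (intro tendsto_mult LIMSEQ_power_zero tendsto_const) simp
    then have "eventually (\<lambda>k. ?q ^ k * (\<alpha> * lam ^ ?l) < ?w) sequentially"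
      using w by (intro order_tendstoD(2)) auto
    then obtain k where "?q ^ k * (\<alpha> * lam ^ ?l) < ?w"
      by (auto simp: eventually_sequentially)
    then have "?r ^ k * (?q ^ k * (\<alpha> * lam ^ ?l)) < ?r ^ k * ?w" using r by simp
    moreover have "?r ^ k * ?q ^ k = (lam ^ length B) ^ k"
      using r by (simp add: power_mult_distrib[symmetric])
    ultimately show ?thesis by (metis mult.assoc)
  qed
  then obtain k where "(lam ^ length B) ^ k * (\<alpha> * lam ^ ?l) < ?r ^ k * ?w" by blast
  then have "\<alpha> * lam ^ length (?X k) < weight s (?X k) t"
    unfolding weight len power_add power_mult by (simp only: mult_ac)
  then show ?thesis using walk B(1) by (intro exI[of _ "?X k"]) auto
qed

text \<open>The factor 3 comes from the three segments of a short pumpable walk. If no walk between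
  the given ends is pumpable, a short exceeding walk serves as \<open>B\<close>, with
  \<open>A\<close> and \<open>C\<close> empty.\<close>

theorem exceeding_walk_iff:
  "(\<exists>s vs t. walk s vs t \<and> vs \<noteq> [] \<and> \<alpha> * lam ^ length vs < weight s vs t) \<longleftrightarrow>
   (\<exists>s A B C t. walk s (A @ B @ C) t \<and> A @ B @ C \<noteq> [] \<and> length (A @ B @ C) \<le> 3 * card V \<and>
      (\<alpha> * lam ^ length (A @ B @ C) < weight s (A @ B @ C) t \<or>
       0 < weight s (A @ B @ C) t \<and> gaining_cycle B))"
  (is "?l \<longleftrightarrow> ?r")
proof
  assume ?l
  then obtain s vs t where vs: "walk s vs t" "vs \<noteq> []" "\<alpha> * lam ^ length vs < weight s vs t"
    by blast
  show ?r
  proof (cases "\<exists>A B C. pumpable s A B C t")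
    case True
    then obtain A B C where "pumpable s A B C t"
      "length A \<le> card V" "length B \<le> card V" "length C \<le> card V"
      using short_pumpable by blast
    then show ?thesis
      by (intro exI[of _ s] exI[of _ A] exI[of _ B] exI[of _ C] exI[of _ t])
        (auto simp: pumpable_def gaining_cycle_def)
  next
    case False
    then obtain us where "walk s us t" "us \<noteq> []" "\<alpha> * lam ^ length us < weight s us t" "length us \<le> card V"
      using short_exceeding_walk[OF _ vs] by blast
    then show ?thesis
      by (intro exI[of _ s] exI[of _ "[]"] exI[of _ us] exI[of _ "[]"] exI[of _ t]) auto
  qed
next
  assume ?r
  then show ?l using pump unfolding pumpable_def by blast
qed

section \<open>Walks as functions of the position\<close>

definition walk_fun :: "nat \<Rightarrow> (nat \<Rightarrow> 'v) \<Rightarrow> bool" where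
  "walk_fun n v \<longleftrightarrow> (\<forall>k<n + 2. v k \<in> V) \<and> (\<forall>k<n + 1. E (v k) (v (Suc k)))"

definition weight_fun :: "nat \<Rightarrow> (nat \<Rightarrow> 'v) \<Rightarrow> real" where
  "weight_fun n v = a (v 0) * (\<Prod>k<n. b (v (Suc k))) * c (v (Suc n))"

lemma walk_map_upt: "walk (v 0) (map v [1..<Suc n]) (v (Suc n)) \<longleftrightarrow> walk_fun n v"
proof -
  have "v 0 # map v [1..<Suc n] @ [v (Suc n)] = map v [0..<n + 2]"
  proof -
    have "[0..<n + 2] = 0 # [Suc 0..<Suc (Suc n)]" by (simp add: upt_conv_Cons del: upt_Suc)
    also have "[Suc 0..<Suc (Suc n)] = [Suc 0..<Suc n] @ [Suc n]" by (subst upt_Suc) simp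
    finally show ?thesis by (simp del: upt_Suc)
  qed
  then show ?thesis
    by (simp only: walk_def walk_fun_def successively_map_upt set_map set_upt image_subset_iff
        atLeast0LessThan lessThan_iff Ball_def le0 simp_thms) simp
qed

lemma prod_list_map_Suc_upt:
  "prod_list (map b (map v [Suc i..<Suc j])) = (\<Prod>k<j - i. b (v (Suc (i + k))))"
proof (cases "i \<le> j")
  case True
  have "(\<Prod>k\<in>{i..<j}. b (v (Suc k))) = (\<Prod>k<j - i. b (v (Suc (i + k))))"
    using prod.shift_bounds_nat_ivl[of "\<lambda>k. b (v (Suc k))" 0 i "j - i"] True
    by (simp add: atLeast0LessThan add.commute)
  then show ?thesis
    by (simp only: map_map prod_list_map_upt prod.shift_bounds_Suc_ivl comp_def)
qed simp

lemma weight_map_upt: "weight (v 0) (map v [1..<Suc n]) (v (Suc n)) = weight_fun n v"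
  using prod_list_map_Suc_upt[of v 0 n] by (simp add: weight_def weight_fun_def del: map_map)

lemma walk_listE:
  obtains v where "s = v 0" "vs = map v [1..<Suc (length vs)]" "t = v (Suc (length vs))"
proof
  let ?v = "(!) (s # vs @ [t])"
  show "vs = map ?v [1..<Suc (length vs)]"
    by (rule nth_equalityI) (auto simp: nth_append simp del: upt_Suc)
qed (auto simp: nth_append)

text \<open>The middle segment occupies positions \<open>Suc i\<close> to \<open>j\<close>; it has
  length \<open>j - i\<close> and closes by the edge from \<open>v j\<close> to
  \<open>v (Suc i)\<close>.\<close>

theorem exceeding_walk_fun_iff:
  "(\<exists>n\<ge>1. \<exists>v. walk_fun n v \<and> \<alpha> * lam ^ n < weight_fun n v) \<longleftrightarrow>
   (\<exists>n\<ge>1. n \<le> 3 * card V \<and> (\<exists>v. walk_fun n v \<and>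
      (\<alpha> * lam ^ n < weight_fun n v \<or>
       0 < weight_fun n v \<and>
       (\<exists>j\<le>n. \<exists>i<j. E (v j) (v (Suc i)) \<and> lam ^ (j - i) < (\<Prod>k<j - i. b (v (Suc (i + k))))))))"
  (is "?l \<longleftrightarrow> ?r")
proof -
  have gc: "gaining_cycle (map v [Suc i..<Suc j]) \<longleftrightarrow>
      E (v j) (v (Suc i)) \<and> lam ^ (j - i) < (\<Prod>k<j - i. b (v (Suc (i + k))))"
    if "i < j" for v i j
    using that unfolding gaining_cycle_def prod_list_map_Suc_upt
    by (simp add: last_map hd_map del: upt_Suc)
  have "?l \<longleftrightarrow> (\<exists>s vs t. walk s vs t \<and> vs \<noteq> [] \<and> \<alpha> * lam ^ length vs < weight s vs t)"
    (is "_ \<longleftrightarrow> ?l'")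
  proof
    assume ?l
    then obtain n v where "1 \<le> n" "walk_fun n v" "\<alpha> * lam ^ n < weight_fun n v" by blast
    then show ?l'
      by (intro exI[of _ "v 0"] exI[of _ "map v [1..<Suc n]"] exI[of _ "v (Suc n)"])
        (simp only: walk_map_upt weight_map_upt, simp)
  next
    assume ?l'
    then obtain s vs t where *: "walk s vs t" "vs \<noteq> []" "\<alpha> * lam ^ length vs < weight s vs t"
      by blast
    obtain v where "s = v 0" "vs = map v [1..<Suc (length vs)]" "t = v (Suc (length vs))"
      by (rule walk_listE)
    with * have "walk_fun (length vs) v" "\<alpha> * lam ^ length vs < weight_fun (length vs) v"
      using walk_map_upt weight_map_upt by metis+
    with *(2) show ?l by (intro exI[of _ "length vs"]) (auto simp: Suc_le_eq)
  qed
  also note exceeding_walk_iff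
  also have "(\<exists>s A B C t. walk s (A @ B @ C) t \<and> A @ B @ C \<noteq> [] \<and> length (A @ B @ C) \<le> 3 * card V \<and>
      (\<alpha> * lam ^ length (A @ B @ C) < weight s (A @ B @ C) t \<or>
       0 < weight s (A @ B @ C) t \<and> gaining_cycle B)) \<longleftrightarrow> ?r" (is "?l' \<longleftrightarrow> _")
  proof
    assume ?l'
    then obtain s A B C t where *: "walk s (A @ B @ C) t" "A @ B @ C \<noteq> []"
      "length (A @ B @ C) \<le> 3 * card V"
      "\<alpha> * lam ^ length (A @ B @ C) < weight s (A @ B @ C) t \<or>
       0 < weight s (A @ B @ C) t \<and> gaining_cycle B" by blast
    define n i j where "n = length (A @ B @ C)" "i = length A" "j = length (A @ B)"
    obtain v where v: "s = v 0" "A @ B @ C = map v [1..<Suc n]" "t = v (Suc n)"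
      unfolding n_i_j_def by (rule walk_listE)
    have "B = take (j - i) (drop i (A @ B @ C))" by (simp add: n_i_j_def)
    also have "\<dots> = map v [Suc i..<Suc j]"
      unfolding v by (simp add: take_map drop_map n_i_j_def del: upt_Suc)
    finally have B: "B = map v [Suc i..<Suc j]" .
    have "walk_fun n v" "weight_fun n v = weight s (A @ B @ C) t"
      using * v walk_map_upt weight_map_upt by metis+
    moreover have "gaining_cycle B \<Longrightarrow> i < j"
      by (auto simp: n_i_j_def gaining_cycle_def)
    moreover have "j \<le> n" by (auto simp: n_i_j_def)
    moreover have "1 \<le> n" using *(2) by (auto simp: n_i_j_def Suc_le_eq)
    ultimately have "\<alpha> * lam ^ n < weight_fun n v \<or> 0 < weight_fun n v \<and>
       (\<exists>j\<le>n. \<exists>i<j. E (v j) (v (Suc i)) \<and> lam ^ (j - i) < (\<Prod>k<j - i. b (v (Suc (i + k)))))"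
      using *(4)[folded n_i_j_def] gc[of i j v, folded B] by auto
    with \<open>1 \<le> n\<close> \<open>walk_fun n v\<close> *(3)[folded n_i_j_def] show ?r by blast
  next
    assume ?r
    then obtain n v where *: "1 \<le> n" "n \<le> 3 * card V" "walk_fun n v"
      and **: "\<alpha> * lam ^ n < weight_fun n v \<or> 0 < weight_fun n v \<and>
       (\<exists>j\<le>n. \<exists>i<j. E (v j) (v (Suc i)) \<and> lam ^ (j - i) < (\<Prod>k<j - i. b (v (Suc (i + k)))))"
      by blast
    obtain i j where ij: "i \<le> j" "j \<le> n" and
      ***: "\<alpha> * lam ^ n < weight_fun n v \<or> 0 < weight_fun n v \<and> gaining_cycle (map v [Suc i..<Suc j])"
    proof (cases "\<alpha> * lam ^ n < weight_fun n v")
      case True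
      \<comment> \<open>Any cut positions do here; the empty segment is taken.\<close>
      then show ?thesis using that[of 0 0] by simp
    next
      case False
      then obtain i j where "j \<le> n" "i < j" "0 < weight_fun n v" "E (v j) (v (Suc i))"
        "lam ^ (j - i) < (\<Prod>k<j - i. b (v (Suc (i + k))))" using ** by blast
      then show ?thesis using that[of i j] gc[of i j v] by simp
    qed
    have eq: "map v [1..<Suc n] = map v [1..<Suc i] @ map v [Suc i..<Suc j] @ map v [Suc j..<Suc n]"
    proof -
      have "[1..<Suc n] = [1..<Suc i] @ [Suc i..<Suc n]"
        using ij upt_add_eq_append[of 1 "Suc i" "n - i"] by (simp del: upt_Suc)
      also have "[Suc i..<Suc n] = [Suc i..<Suc j] @ [Suc j..<Suc n]"
        using ij upt_add_eq_append[of "Suc i" "Suc j" "n - j"] by (simp del: upt_Suc)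
      finally show ?thesis by (simp del: upt_Suc)
    qed
    show ?l'
    proof (intro exI conjI)
      let ?vs = "map v [1..<Suc i] @ map v [Suc i..<Suc j] @ map v [Suc j..<Suc n]"
      have len: "length ?vs = n" unfolding eq[symmetric] by simp
      show "walk (v 0) ?vs (v (Suc n))"
        unfolding eq[symmetric] walk_map_upt by (rule *)
      show "?vs \<noteq> []" using len *(1) by (metis list.size(3) not_one_le_zero)
      show "length ?vs \<le> 3 * card V" unfolding len by (rule *)
      show "\<alpha> * lam ^ length ?vs < weight (v 0) ?vs (v (Suc n)) \<or>
        0 < weight (v 0) ?vs (v (Suc n)) \<and> gaining_cycle (map v [Suc i..<Suc j])"
        unfolding len unfolding eq[symmetric] weight_map_upt by (rule ***)
    qed
  qed
  finally show ?thesis .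
qed

end

section \<open>Cylinder probabilities and digits\<close>

lemma random_nbhd_cfca: "is_cfca A \<Longrightarrow> random_nbhd A = [0]"
  by (cases "random_nbhd A"; cases "tl (random_nbhd A)")
    (auto simp: is_cfca_def is_stochastic_ca_def)

text \<open>Each cell reads only the random symbol at its own position, so the letters of the
  pattern are independent.\<close>

lemma measure_cylinder_cfca:
  assumes A: "is_cfca A" and c: "c \<in> configurations A" and u: "set u \<subseteq> states A"
  shows "measure (ca_law A c) (cylinder A u 0) =
    (\<Prod>k<length u. real (card {r \<in> symbols A. local_rule A (map (\<lambda>v. c (int k + v)) (nbhd A)) [r] = u ! k})
      / real (card (symbols A)))"
proof -
  note rn = random_nbhd_cfca[OF A]
  have sca: "is_stochastic_ca A" using A by (simp add: is_cfca_def)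
  then have fin: "finite (symbols A)" "symbols A \<noteq> {}" by (auto simp: is_stochastic_ca_def)
  let ?U = "uniform_count_measure (symbols A)"
  let ?S = "\<Pi>\<^sub>M i\<in>(UNIV::int set). ?U"
  interpret prob_space ?U by (rule prob_space_uniform_count_measure) (use fin in auto)
  interpret product_prob_space "\<lambda>_. ?U" "UNIV::int set" ..
  define X where "X i = {r \<in> symbols A. local_rule A (map (\<lambda>v. c (i + v)) (nbhd A)) [r] = u ! nat i}" for i
  let ?J = "int ` {..<length u}"
  have "measure (ca_law A c) (cylinder A u 0) = measure ?S (global_fun A c -` cylinder A u 0 \<inter> space ?S)"
    unfolding ca_law_def
    using global_fun_measurable[OF sca c] cylinder_in_sets[OF u, of 0 c] u
    by (intro measure_distr) (auto simp: ca_law_def)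
  \<comment> \<open>As the random neighbourhood is \<open>[0]\<close>, the event constrains each
    \<open>s i\<close> separately and is a box over finitely many coordinates.\<close>
  also have "global_fun A c -` cylinder A u 0 \<inter> space ?S = prod_emb UNIV (\<lambda>_. ?U) ?J (Pi\<^sub>E ?J X)"
  proof (intro set_eqI)
    fix s :: "int \<Rightarrow> 'b"
    have "global_fun A c s \<in> configurations A" if "s \<in> space ?S"
      using measurable_space[OF global_fun_measurable[OF sca c] that]
      by (auto simp: configurations_def space_PiM PiE_iff)
    then show "s \<in> global_fun A c -` cylinder A u 0 \<inter> space ?S \<longleftrightarrow>
        s \<in> prod_emb UNIV (\<lambda>_. ?U) ?J (Pi\<^sub>E ?J X)"
      by (auto simp: cylinder_def prod_emb_iff PiE_iff space_PiM space_uniform_count_measure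
          X_def global_fun_def rn)
  qed
  also have "measure ?S \<dots> = (\<Prod>i\<in>?J. measure ?U (X i))"
    by (rule measure_PiM_emb) (auto simp: X_def sets_uniform_count_measure)
  also have "\<dots> = (\<Prod>k<length u. measure ?U (X (int k)))"
    by (simp add: prod.reindex)
  also have "\<dots> = (\<Prod>k<length u. real (card (X (int k))) / real (card (symbols A)))"
    using fin by (intro prod.cong measure_uniform_count_measure) (auto simp: X_def)
  finally show ?thesis by (simp add: X_def)
qed

section \<open>Tables of words and digits in base \<open>q\<close>\<close>

lemma concat_nth_uniform:
  "\<forall>ys\<in>set xss. length ys = q \<Longrightarrow> i < length xss \<Longrightarrow> r < q \<Longrightarrow> concat xss ! (i * q + r) = xss ! i ! r"
proof (induction xss arbitrary: i)
  case (Cons ys xss)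
  then show ?case by (cases i) (auto simp: nth_append add.assoc)
qed simp

lemma sum_digits_Suc:
  "(\<Sum>j<Suc m. d j * q ^ j) = d 0 + q * (\<Sum>j<m. d (Suc j) * q ^ j)" for q :: nat
  by (simp only: sum.lessThan_Suc_shift) (simp add: sum_distrib_left mult_ac)

lemma sum_digits_less: "(\<forall>j<m. d j < q) \<Longrightarrow> (\<Sum>j<m. d j * q ^ j) < q ^ m" for q :: nat
proof (induction m)
  case (Suc m)
  then have "d m * q ^ m + (\<Sum>j<m. d j * q ^ j) < d m * q ^ m + q ^ m" by simp
  also have "\<dots> = Suc (d m) * q ^ m" by simp
  also have "\<dots> \<le> q * q ^ m" using Suc.prems by (intro mult_right_mono) (auto simp: Suc_le_eq)
  finally show ?case by (simp add: add.commute)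
qed simp

text \<open>\<open>List.n_lists\<close> prepends the new letter in its inner loop, so digit 0
  locates a word inside its block and the remaining digits locate the block.\<close>

lemma nth_n_lists:
  "\<forall>j<n. d j < length xs \<Longrightarrow>
   List.n_lists n xs ! (\<Sum>j<n. d j * length xs ^ j) = map (\<lambda>j. xs ! d j) [0..<n]"
proof (induction n arbitrary: d)
  case (Suc n)
  let ?i = "\<Sum>j<n. d (Suc j) * length xs ^ j"
  let ?f = "\<lambda>ys. map (\<lambda>y. y # ys) xs"
  have "?i < length (List.n_lists n xs)"
    using Suc.prems sum_digits_less[of n "\<lambda>j. d (Suc j)"] by (simp add: length_n_lists)
  moreover have "(\<Sum>j<Suc n. d j * length xs ^ j) = ?i * length xs + d 0"
    by (simp only: sum_digits_Suc) simp
  ultimately have "List.n_lists (Suc n) xs ! (\<Sum>j<Suc n. d j * length xs ^ j) =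
      (xs ! d 0) # (List.n_lists n xs ! ?i)"
    using Suc.prems concat_nth_uniform[of "map ?f (List.n_lists n xs)" "length xs" ?i "d 0"] by simp
  also have "\<dots> = map (\<lambda>j. xs ! d j) (0 # map Suc [0..<n])"
    using Suc.IH[of "\<lambda>j. d (Suc j)"] Suc.prems by simp
  finally show ?case by (simp add: map_Suc_upt upt_conv_Cons del: upt_Suc)
qed simp

definition digit :: "nat \<Rightarrow> nat \<Rightarrow> nat \<Rightarrow> nat" where
  "digit q u k = u div q ^ k mod q"

lemma rc_digit: "rc a \<Longrightarrow> rc b \<Longrightarrow> rc c \<Longrightarrow> rc (\<lambda>e. digit (a e) (b e) (c e))"
  unfolding digit_def by (intro rc_rules)

lemma digit_Suc: "digit q u (Suc k) = digit q (u div q) k"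
  by (simp add: digit_def div_mult2_eq)

lemma digit_sum_digits:
  "\<forall>j<m. d j < q \<Longrightarrow> k < m \<Longrightarrow> digit q (\<Sum>j<m. d j * q ^ j) k = d k"
proof (induction m arbitrary: d k)
  case (Suc m)
  have d: "d 0 < q" using Suc.prems by simp
  show ?case
  proof (cases k)
    case 0
    then show ?thesis using d by (simp only: sum_digits_Suc) (simp add: digit_def)
  next
    case (Suc k')
    have "(d 0 + q * x) div q = x" for x using d by simp
    then show ?thesis
      using Suc Suc.IH[of "\<lambda>j. d (Suc j)" k'] Suc.prems
      by (simp only: sum_digits_Suc digit_Suc) simp
  qed
qed simp

text \<open>For \<open>k < n\<close> the modulus \<open>q ^ n\<close> is a multiple of
  \<open>q ^ Suc k\<close>, so the reduction does not affect digit \<open>k\<close>.\<close>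

lemma digit_mod_power:
  assumes "k < n" shows "digit q (v mod q ^ n) k = digit q v k"
proof (cases "q = 0")
  case True
  then show ?thesis using assms by (simp add: power_0_left)
next
  case False
  have n: "q ^ n = q ^ k * q ^ (n - k)" using assms by (simp add: power_add[symmetric])
  have "q dvd q ^ (n - k)" using assms by (simp add: dvd_power)
  moreover have "v mod q ^ n div q ^ k = v div q ^ k mod q ^ (n - k)"
    unfolding n using False by (simp add: mod_mult2_eq)
  ultimately show ?thesis by (simp add: digit_def mod_mod_cancel)
qed

section \<open>Windows of an encoded automaton\<close>

definition num_states :: "nat \<Rightarrow> nat" where
  "num_states C = code_length (code_nth C 0)"

definition num_symbols :: "nat \<Rightarrow> nat" where
  "num_symbols C = code_length (code_nth C 1)"

text \<open>
  The code of the list of neighbours bounds their absolute values, hence serves as a radius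
  containing the neighbourhood.
\<close>

definition radius :: "nat \<Rightarrow> nat" where
  "radius C = code_nth C 2"

text \<open>
  The position \<open>v\<^sub>j\<close> relative to the left end of the window; even codes under
  \<^const>\<open>int_encode\<close> are the nonnegative integers.
\<close>

definition offset :: "nat \<Rightarrow> nat \<Rightarrow> nat" where
  "offset l j = (if code_nth l j mod 2 = 0 then l + code_nth l j div 2
                 else l - Suc (code_nth l j) div 2)"

text \<open>Windows have \<open>2 * radius C + 1\<close> cells, centred at the cell they
  update.\<close>

definition node_count :: "nat \<Rightarrow> nat" where
  "node_count C = num_states C ^ Suc (2 * radius C)"

text \<open>
  A window is read as a number in base \<open>|Q|\<close> whose least significant digit is its leftmost cell.
\<close>

definition adjacent :: "nat \<Rightarrow> nat \<Rightarrow> nat \<Rightarrow> bool" where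
  "adjacent C u v \<longleftrightarrow> u div num_states C = v mod num_states C ^ (2 * radius C)"

text \<open>
  In the order of \<^const>\<open>List.n_lists\<close> the first letter varies fastest.
\<close>

definition row :: "nat \<Rightarrow> nat \<Rightarrow> nat" where
  "row C u = (\<Sum>j<code_length (radius C). digit (num_states C) u (offset (radius C) j) * num_states C ^ j)"

text \<open>Numerator of a local probability with denominator \<open>num_symbols C\<close>.
  Component 4 of the code is the rule table; with random neighbourhood {0} it has one entry per
  symbol for each word of neighbours.\<close>

definition hits :: "nat \<Rightarrow> nat \<Rightarrow> nat \<Rightarrow> nat" where
  "hits C u y = (\<Sum>s<num_symbols C. if code_nth (code_nth C 4) (row C u * num_symbols C + s) = y then 1 else 0)"

lemma rc_num_states: "rc a \<Longrightarrow> rc (\<lambda>e. num_states (a e))"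
  unfolding num_states_def by (intro rc_code_length rc_code_nth rc_rules)

lemma rc_num_symbols: "rc a \<Longrightarrow> rc (\<lambda>e. num_symbols (a e))"
  unfolding num_symbols_def by (intro rc_code_length rc_code_nth rc_rules)

lemma rc_radius: "rc a \<Longrightarrow> rc (\<lambda>e. radius (a e))"
  unfolding radius_def by (intro rc_code_nth rc_rules)

lemma rc_offset: "rc a \<Longrightarrow> rc b \<Longrightarrow> rc (\<lambda>e. offset (a e) (b e))"
  unfolding offset_def by (intro rc_code_nth rc_rules)

lemma rc_node_count: "rc a \<Longrightarrow> rc (\<lambda>e. node_count (a e))"
  unfolding node_count_def by (intro rc_num_states rc_radius rc_rules)

lemma rcp_adjacent: "rc a \<Longrightarrow> rc b \<Longrightarrow> rc c \<Longrightarrow> rcp (\<lambda>e. adjacent (a e) (b e) (c e))"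
  unfolding adjacent_def by (intro rc_num_states rc_radius rc_rules)

lemma rc_row: "rc a \<Longrightarrow> rc b \<Longrightarrow> rc (\<lambda>e. row (a e) (b e))"
  by (rule rc_lift2)
    (unfold row_def, intro rc_num_states rc_radius rc_offset rc_digit rc_code_length rc_rules)

lemma rc_hits: "rc a \<Longrightarrow> rc b \<Longrightarrow> rc c \<Longrightarrow> rc (\<lambda>e. hits (a e) (b e) (c e))"
  by (rule rc_lift3)
    (unfold hits_def, intro rc_num_symbols rc_row rc_code_nth rc_rules)

section \<open>Correctness of the window encoding\<close>

locale encoded_cfca =
  fixes A :: "(nat, nat) stochastic_ca"
  assumes cfca: "is_cfca A"
begin

abbreviation "C \<equiv> encode_ca A"
abbreviation "qs \<equiv> sorted_list_of_set (states A)"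
abbreviation "rs \<equiv> sorted_list_of_set (symbols A)"
abbreviation "q \<equiv> card (states A)"
abbreviation "S \<equiv> radius C"

lemma finite_nonempty: "finite (states A)" "finite (symbols A)" "states A \<noteq> {}" "symbols A \<noteq> {}"
  using cfca by (auto simp: is_cfca_def is_stochastic_ca_def)

lemma q_pos: "0 < q"
  using finite_nonempty by (simp add: card_gt_0_iff)

lemma num_states_encode: "num_states C = q"
  by (simp add: num_states_def encode_ca_def Let_def code_nth code_length del: list_encode.simps)

lemma num_symbols_encode: "num_symbols C = card (symbols A)"
  by (simp add: num_symbols_def encode_ca_def Let_def code_nth code_length del: list_encode.simps)

lemma radius_encode: "S = list_encode (map int_encode (nbhd A))"
  by (simp add: radius_def encode_ca_def Let_def code_nth del: list_encode.simps)

text \<open>\<open>int_encode\<close> of an integer is at least its absolute value, so the radius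
  covers every neighbour and the subtraction in \<open>offset\<close> is never truncated.\<close>

lemma offset_encode:
  assumes "j < length (nbhd A)"
  shows "int (offset S j) = nbhd A ! j + int S" "offset S j < Suc (2 * S)"
proof -
  let ?v = "nbhd A ! j"
  have n: "code_nth S j = int_encode ?v"
    using assms by (simp add: radius_encode code_nth)
  have "int_encode ?v \<le> S"
    unfolding radius_encode using assms by (intro member_le_list_encode) auto
  then have "int (offset S j) = ?v + int S \<and> offset S j < Suc (2 * S)"
    unfolding offset_def n by (auto simp: int_encode_def sum_encode_def)
  then show "int (offset S j) = nbhd A ! j + int S" "offset S j < Suc (2 * S)" by auto
qed

lemma n_lists_1: "List.n_lists (Suc 0) xs = map (\<lambda>x. [x]) xs"
  by (simp add: concat_map_singleton)

lemma hits_encode: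
  "hits C u y = card {r \<in> symbols A.
     local_rule A (map (\<lambda>j. qs ! digit q u (offset S j)) [0..<length (nbhd A)]) [r] = y}"
proof -
  let ?n = "length (nbhd A)" and ?R = "card (symbols A)"
  let ?d = "\<lambda>j. digit q u (offset S j)"
  let ?w = "map (\<lambda>j. qs ! ?d j) [0..<?n]"
  let ?row = "\<lambda>u. map (\<lambda>w. local_rule A u w) (List.n_lists (Suc 0) rs)"
  \<comment> \<open>Digits are reduced modulo \<open>q > 0\<close>, hence are valid indices for
    every number \<open>u\<close>.\<close>
  have d: "\<forall>j<?n. ?d j < length qs" using q_pos by (simp add: digit_def)
  have row: "row C u = (\<Sum>j<?n. ?d j * length qs ^ j)"
    by (simp add: row_def num_states_encode) (simp add: radius_encode code_length)
  have tab: "code_nth C 4 = list_encode (concat (map ?row (List.n_lists ?n qs)))"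
    by (simp add: encode_ca_def Let_def code_nth random_nbhd_cfca[OF cfca] del: n_lists.simps list_encode.simps)
  have less: "row C u < length (List.n_lists ?n qs)"
    unfolding row length_n_lists using sum_digits_less[OF d] .
  have len: "length (concat (map ?row (List.n_lists ?n qs))) = length (List.n_lists ?n qs) * ?R"
    by (simp add: length_concat comp_def n_lists_1 sum_list_triv)
  have entry: "code_nth (code_nth C 4) (row C u * ?R + s) = local_rule A ?w [rs ! s]" if s: "s < ?R" for s
  proof -
    have "row C u * ?R + s < Suc (row C u) * ?R" using s by simp
    also have "\<dots> \<le> length (List.n_lists ?n qs) * ?R"
      using less by (intro mult_right_mono) auto
    finally have "code_nth (code_nth C 4) (row C u * ?R + s) =
        concat (map ?row (List.n_lists ?n qs)) ! (row C u * ?R + s)"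
      unfolding tab by (intro code_nth) (simp only: len)
    also have "\<dots> = map ?row (List.n_lists ?n qs) ! row C u ! s"
      using s less by (intro concat_nth_uniform) (auto simp: n_lists_1)
    also have "\<dots> = ?row ?w ! s"
      using less nth_n_lists[OF d] by (simp add: row)
    finally show ?thesis using s by (simp add: n_lists_1)
  qed
  have "hits C u y = (\<Sum>s<?R. if local_rule A ?w [rs ! s] = y then 1 else 0)"
    unfolding hits_def num_symbols_encode by (intro sum.cong refl) (simp add: entry)
  also have "\<dots> = (\<Sum>r\<in>symbols A. if local_rule A ?w [r] = y then 1 else 0)"
    using bij_betw_nth[of rs "{..<?R}" "symbols A"] finite_nonempty(2)
    by (intro sum.reindex_bij_betw) auto
  also have "\<dots> = card {r \<in> symbols A. local_rule A ?w [r] = y}"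
    using finite_nonempty(2) by (simp add: sum.If_cases Int_def)
  finally show ?thesis .
qed

text \<open>\<open>v t\<close> codes the window of \<open>c\<close> around cell \<open>t\<close>,
  its digits being indices into \<open>qs\<close>; the pattern sits on the cells 0 to
  \<open>n + 1\<close>.\<close>

definition walk_of :: "nat \<Rightarrow> (int \<Rightarrow> nat) \<Rightarrow> (nat \<Rightarrow> nat) \<Rightarrow> bool" where
  "walk_of n c v \<longleftrightarrow> (\<forall>t<n + 2. \<forall>k<Suc (2 * S). qs ! digit q (v t) k = c (int t - int S + int k))"

lemma hits_walk_of:
  assumes "walk_of n c v" "t < n + 2"
  shows "hits C (v t) y = card {r \<in> symbols A. local_rule A (map (\<lambda>v. c (int t + v)) (nbhd A)) [r] = y}"
proof -
  have "qs ! digit q (v t) (offset S j) = c (int t + nbhd A ! j)" if "j < length (nbhd A)" for j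
    using assms offset_encode[OF that] by (simp add: walk_of_def)
  then have "map (\<lambda>j. qs ! digit q (v t) (offset S j)) [0..<length (nbhd A)] = map (\<lambda>v. c (int t + v)) (nbhd A)"
    by (intro nth_equalityI) auto
  then show ?thesis by (simp only: hits_encode)
qed

lemma ex_walk_of:
  assumes c: "c \<in> configurations A"
  shows "\<exists>v. walk_of n c v \<and> (\<forall>t. v t < node_count C) \<and> (\<forall>t. adjacent C (v t) (v (Suc t)))"
proof -
  have bij: "bij_betw ((!) qs) {..<q} (states A)"
    using finite_nonempty by (intro bij_betw_nth) auto
  have "\<forall>i. \<exists>k. k < q \<and> qs ! k = c i"
  proof
    fix i
    have "c i \<in> (!) qs ` {..<q}"
      using bij c by (auto simp: bij_betw_def configurations_def)
    then show "\<exists>k. k < q \<and> qs ! k = c i" by auto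
  qed
  then obtain f where f: "f i < q" "qs ! f i = c i" for i by metis
  define g where "g t k = f (int t - int S + int k)" for t k
  define v where "v t = (\<Sum>k<Suc (2 * S). g t k * q ^ k)" for t
  have g: "g t k < q" "qs ! g t k = c (int t - int S + int k)" for t k
    using f by (auto simp: g_def)
  \<comment> \<open>Consecutive windows overlap in all but one cell at either end.\<close>
  have shift: "g t (Suc k) = g (Suc t) k" for t k
    by (simp add: g_def algebra_simps)
  have "walk_of n c v"
    unfolding walk_of_def
  proof (intro allI impI)
    fix t k assume "k < Suc (2 * S)"
    then have "digit q (v t) k = g t k"
      unfolding v_def by (intro digit_sum_digits) (auto simp: g)
    then show "qs ! digit q (v t) k = c (int t - int S + int k)" by (simp add: g)
  qed
  moreover have "v t < node_count C" for t
    unfolding v_def node_count_def num_states_encode by (intro sum_digits_less) (simp add: g)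
  moreover have "adjacent C (v t) (v (Suc t))" for t
  proof -
    \<comment> \<open>Division by \<open>q\<close> drops the leftmost cell of a window; reduction
      modulo \<open>q ^ (2 * S)\<close> drops the rightmost cell of the next one.\<close>
    have "v t div q = (\<Sum>k<2 * S. g t (Suc k) * q ^ k)"
      using g(1)[of t 0] unfolding v_def by (simp only: sum_digits_Suc) simp
    also have "\<dots> = (\<Sum>k<2 * S. g (Suc t) k * q ^ k) mod q ^ (2 * S)"
      using sum_digits_less[of "2 * S" "g (Suc t)" q] g by (simp add: shift)
    also have "\<dots> = v (Suc t) mod q ^ (2 * S)"
      by (simp add: v_def)
    finally show ?thesis by (simp add: adjacent_def num_states_encode)
  qed
  ultimately show ?thesis by blast
qed

text \<open>Overlapping windows glue together: the walk spells the cells from \<open>- S\<close> to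
  \<open>n + 1 + S\<close>.\<close>

lemma ex_configuration:
  assumes v: "\<forall>t<n + 1. adjacent C (v t) (v (Suc t))"
  shows "\<exists>c \<in> configurations A. walk_of n c v"
proof -
  \<comment> \<open>Positions are counted from cell \<open>- S\<close>. Each window contributes its
    leftmost letter, the last one all its letters. Outside that range, further digits on the right
    and truncation by \<open>nat\<close> on the left still yield states.\<close>
  define h where "h p = (if p \<le> n + 1 then digit q (v p) 0 else digit q (v (n + 1)) (p - (n + 1)))" for p
  define c where "c i = qs ! h (nat (i + int S))" for i
  have "digit q x k < length qs" for x k using q_pos by (simp add: digit_def)
  then have "c i \<in> set qs" for i
    unfolding c_def h_def by (intro nth_mem) simp
  then have "c \<in> configurations A" using finite_nonempty by (simp add: configurations_def)
  have step: "digit q (v t) (Suc k) = digit q (v (Suc t)) k" if "t < n + 1" "k < 2 * S" for t k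
  proof -
    have "digit q (v t) (Suc k) = digit q (v (Suc t) mod q ^ (2 * S)) k"
      using v that by (simp add: digit_Suc adjacent_def num_states_encode)
    then show ?thesis using that by (simp add: digit_mod_power)
  qed
  \<comment> \<open>A positive digit \<open>k\<close> of a window is digit \<open>k - 1\<close> of
    the next; this is followed until digit 0 or the last window is reached.\<close>
  have "digit q (v t) k = h (t + k)" if "t \<le> n + 1" "k < Suc (2 * S)" for t k
    using that
  proof (induction k arbitrary: t)
    case 0
    then show ?case by (simp add: h_def)
  next
    case (Suc k)
    show ?case
    proof (cases "t = n + 1")
      case True
      then show ?thesis by (simp add: h_def)
    next
      case False
      then show ?thesis using Suc.IH[of "Suc t"] Suc.prems step[of t k] by simp
    qed
  qed
  then have "walk_of n c v" by (simp add: walk_of_def c_def nat_add_distrib flip: of_nat_add)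
  with \<open>c \<in> configurations A\<close> show ?thesis by blast
qed

end

section \<open>The search\<close>

text \<open>Turns a quantifier over vertex sequences into a bounded one over numbers, as
  \<open>rcp_ex\<close> requires; \<open>cong\<close> says that only the first \<open>m\<close>
  values matter.\<close>

lemma ex_digits_iff:
  assumes "0 < b" and cong: "\<And>v w. \<forall>k<m. v k = w k \<Longrightarrow> P v \<Longrightarrow> P w"
  shows "(\<exists>v. (\<forall>k<m. v k < b) \<and> P v) \<longleftrightarrow> (\<exists>W<b ^ m. P (digit b W))"
proof
  assume "\<exists>v. (\<forall>k<m. v k < b) \<and> P v"
  then obtain v where v: "\<forall>k<m. v k < b" "P v" by blast
  let ?W = "\<Sum>k<m. v k * b ^ k"
  have "P (digit b ?W)"
    using v(1) digit_sum_digits[OF v(1)] by (intro cong[OF _ v(2)]) auto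
  with sum_digits_less[OF v(1)] show "\<exists>W<b ^ m. P (digit b W)" by blast
next
  have "digit b W k < b" for W k using \<open>0 < b\<close> by (simp add: digit_def)
  moreover assume "\<exists>W<b ^ m. P (digit b W)"
  ultimately show "\<exists>v. (\<forall>k<m. v k < b) \<and> P v" by blast
qed

context threshold_walks
begin

text \<open>The criterion of \<open>exceeding_walk_fun_iff\<close>, with \<open>j \<le> n\<close> in
  the strict form of the bounded quantifiers.\<close>

definition witness :: "nat \<Rightarrow> (nat \<Rightarrow> 'v) \<Rightarrow> bool" where
  "witness n v \<longleftrightarrow> \<alpha> * lam ^ n < weight_fun n v \<or> 0 < weight_fun n v \<and>
     (\<exists>j<n + 1. \<exists>i<j. E (v j) (v (Suc i)) \<and> lam ^ (j - i) < (\<Prod>k<j - i. b (v (Suc (i + k)))))"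

lemma witness_cong:
  assumes eq: "\<forall>k<n + 2. v k = w k" and v: "witness n v"
  shows "witness n w"
proof -
  have "weight_fun n v = weight_fun n w"
    using eq by (simp add: weight_fun_def)
  moreover have "(\<Prod>k<j - i. b (v (Suc (i + k)))) = (\<Prod>k<j - i. b (w (Suc (i + k))))"
    if "j < n + 1" "i < j" for i j
    using eq that by (intro prod.cong) auto
  moreover have "v j = w j" "v (Suc i) = w (Suc i)" if "j < n + 1" "i < j" for i j
    using eq that by auto
  ultimately show ?thesis using v unfolding witness_def by metis
qed

end

section \<open>The search as a recursive predicate\<close>

lemma rc_list5:
  assumes "recursive_fn 5 g" "rc a" "rc b" "rc c" "rc d" "rc f"
  shows "rc (\<lambda>p. g [a p, b p, c p, d p, f p])"
proof -
  have "tot_rec 5 g" using assms(1) by (auto simp: tot_rec_def)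
  then show ?thesis
    using assms(2-) rec_comp[of "map (\<lambda>h xs. h (xs ! 0)) [a, b, c, d, f]" g 1]
    by (simp add: rc_def eval_nat_numeral)
qed

text \<open>Numerator of the weight of a walk over the common denominator
  \<open>num_symbols C ^ (n + 2)\<close>.\<close>

definition walk_hits :: "nat \<Rightarrow> nat \<Rightarrow> nat \<Rightarrow> nat \<Rightarrow> nat \<Rightarrow> nat \<Rightarrow> nat" where
  "walk_hits C x y z n W =
     hits C (digit (node_count C) W 0) x *
     (\<Prod>k<n. hits C (digit (node_count C) W (Suc k)) y) *
     hits C (digit (node_count C) W (Suc n)) z"

text \<open>\<open>g\<close> stands for a procedure comparing rationals with powers: flag 1 includes
  the factor \<alpha>, flag 0 does not. The digits of \<open>W\<close> in base
  \<open>node_count C\<close> are the \<open>n + 2\<close> vertices of a walk.\<close>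

definition PPT_search :: "(nat list \<Rightarrow> nat) \<Rightarrow> nat \<Rightarrow> nat \<Rightarrow> nat \<Rightarrow> nat \<Rightarrow> nat \<Rightarrow> bool" where
  "PPT_search g C x y z e \<longleftrightarrow>
     (\<exists>n<Suc (3 * node_count C). 1 \<le> n \<and> (\<exists>W<node_count C ^ (n + 2).
        (\<forall>k<n + 1. adjacent C (digit (node_count C) W k) (digit (node_count C) W (Suc k))) \<and>
        (g [e, 1, n, walk_hits C x y z n W, num_symbols C ^ (n + 2)] = 1 \<or>
         0 < walk_hits C x y z n W \<and>
         (\<exists>j<n + 1. \<exists>i<j.
            adjacent C (digit (node_count C) W j) (digit (node_count C) W (Suc i)) \<and>
            g [e, 0, j - i, \<Prod>k<j - i. hits C (digit (node_count C) W (Suc (i + k))) y,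
               num_symbols C ^ (j - i)] = 1))))"

text \<open>All quantifiers have recursive bounds and \<open>g\<close> is called on recursive
  arguments.\<close>

lemma tot_rec_PPT_search:
  assumes "recursive_fn 5 g"
  shows "tot_rec 5 (\<lambda>xs. of_bool (PPT_search g (xs!0) (xs!1) (xs!2) (xs!3) (xs!4)))"
proof -
  have "rcp (\<lambda>p. PPT_search g (pfst p) (pfst (psnd p)) (pfst (psnd (psnd p)))
      (pfst (psnd (psnd (psnd p)))) (psnd (psnd (psnd (psnd p)))))"
    unfolding PPT_search_def walk_hits_def
    by (intro rc_list5[OF assms] rc_num_symbols rc_node_count rcp_adjacent rc_hits rc_digit rc_rules)
  from rc_tot_rec[OF this[unfolded rcp_def], of 5
      "\<lambda>xs. prod_encode (xs!0, prod_encode (xs!1, prod_encode (xs!2, prod_encode (xs!3, xs!4))))"]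
  show ?thesis by (simp add: rec_prod_encode rec_proj)
qed

section \<open>Correctness of the search\<close>

context encoded_cfca
begin

abbreviation "hit_prob u y \<equiv> real (hits C u y) / real (card (symbols A))"

lemma measure_cylinder_walk_of:
  assumes "c \<in> configurations A" "walk_of n c v" "x \<in> states A" "y \<in> states A" "z \<in> states A"
  shows "measure (ca_law A c) (cylinder A ([x] @ replicate n y @ [z]) 0) =
    hit_prob (v 0) x * (\<Prod>k<n. hit_prob (v (Suc k)) y) * hit_prob (v (Suc n)) z"
proof -
  let ?u = "[x] @ replicate n y @ [z]"
  have "measure (ca_law A c) (cylinder A ?u 0) = (\<Prod>k<length ?u. hit_prob (v k) (?u ! k))"
    using assms by (subst measure_cylinder_cfca[OF cfca]) (auto simp: hits_walk_of intro!: prod.cong)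
  also have "length ?u = Suc (Suc n)" by simp
  also have "(\<Prod>k<Suc (Suc n). hit_prob (v k) (?u ! k)) =
      hit_prob (v 0) x * (\<Prod>k<n. hit_prob (v (Suc k)) y) * hit_prob (v (Suc n)) z"
    by (subst prod.lessThan_Suc_shift) (simp add: nth_append mult.assoc)
  finally show ?thesis .
qed

text \<open>Configurations correspond to walks of windows, walks of bounded length suffice, their
  vertices fit into one number, and each remaining comparison is answered by
  \<open>g\<close>.\<close>

lemma PPT_iff_search:
  assumes xyz: "x \<in> states A" "y \<in> states A" "z \<in> states A"
    and \<alpha>: "0 \<le> \<alpha>" and lam: "0 \<le> lam"
    and g1: "\<And>n p m. 0 < m \<Longrightarrow> g [e, 1, n, p, m] = 1 \<longleftrightarrow> \<alpha> * lam ^ n < real p / real m"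
    and g0: "\<And>n p m. 0 < m \<Longrightarrow> g [e, 0, n, p, m] = 1 \<longleftrightarrow> lam ^ n < real p / real m"
  shows "PPT A x y z (\<lambda>n. \<alpha> * lam ^ n) \<longleftrightarrow> PPT_search g C x y z e"
proof -
  let ?b = "node_count C" and ?R = "card (symbols A)"
  interpret threshold_walks "{..<?b}" "adjacent C" "\<lambda>u. hit_prob u x" "\<lambda>u. hit_prob u y"
    "\<lambda>u. hit_prob u z" \<alpha> lam
    using \<alpha> lam by unfold_locales auto
  have b: "0 < ?b" using q_pos by (simp add: node_count_def num_states_encode)
  have R: "0 < ?R" using finite_nonempty by (simp add: card_gt_0_iff)
  have "PPT A x y z (\<lambda>n. \<alpha> * lam ^ n) \<longleftrightarrow>
      (\<exists>n\<ge>1. \<exists>v. walk_fun n v \<and> \<alpha> * lam ^ n < weight_fun n v)" (is "_ \<longleftrightarrow> ?r")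
  proof
    assume "PPT A x y z (\<lambda>n. \<alpha> * lam ^ n)"
    then obtain c n where c: "c \<in> configurations A" "1 \<le> n"
      "\<alpha> * lam ^ n < measure (ca_law A c) (cylinder A ([x] @ replicate n y @ [z]) 0)"
      unfolding PPT_def by blast
    obtain v where v: "walk_of n c v" "\<forall>t. v t < ?b" "\<forall>t. adjacent C (v t) (v (Suc t))"
      using ex_walk_of[OF c(1)] by blast
    have "walk_fun n v" using v by (simp add: walk_fun_def)
    with c(2,3) show ?r unfolding measure_cylinder_walk_of[OF c(1) v(1) xyz] weight_fun_def by blast
  next
    assume ?r
    then obtain n v where v: "1 \<le> n" "walk_fun n v" "\<alpha> * lam ^ n < weight_fun n v" by blast
    obtain c where c: "c \<in> configurations A" "walk_of n c v"
      using ex_configuration[of n v] v(2) by (auto simp: walk_fun_def)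
    have "\<alpha> * lam ^ n < measure (ca_law A c) (cylinder A ([x] @ replicate n y @ [z]) 0)"
      unfolding measure_cylinder_walk_of[OF c xyz] using v(3) unfolding weight_fun_def .
    with v(1) c(1) show "PPT A x y z (\<lambda>n. \<alpha> * lam ^ n)"
      unfolding PPT_def by blast
  qed
  also note exceeding_walk_fun_iff
  also have "(\<exists>n\<ge>1. n \<le> 3 * card {..<?b} \<and> (\<exists>v. walk_fun n v \<and>
      (\<alpha> * lam ^ n < weight_fun n v \<or> 0 < weight_fun n v \<and>
       (\<exists>j\<le>n. \<exists>i<j. adjacent C (v j) (v (Suc i)) \<and>
          lam ^ (j - i) < (\<Prod>k<j - i. hit_prob (v (Suc (i + k))) y))))) \<longleftrightarrow>
    (\<exists>n<Suc (3 * ?b). 1 \<le> n \<and> (\<exists>v. (\<forall>k<n + 2. v k < ?b) \<and>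
       ((\<forall>k<n + 1. adjacent C (v k) (v (Suc k))) \<and> witness n v)))"
    by (auto simp: walk_fun_def witness_def less_Suc_eq_le)
  also have "\<dots> \<longleftrightarrow> (\<exists>n<Suc (3 * ?b). 1 \<le> n \<and> (\<exists>W<?b ^ (n + 2).
      ((\<forall>k<n + 1. adjacent C (digit ?b W k) (digit ?b W (Suc k))) \<and> witness n (digit ?b W))))"
  proof -
    have "(\<exists>v. (\<forall>k<n + 2. v k < ?b) \<and> ((\<forall>k<n + 1. adjacent C (v k) (v (Suc k))) \<and> witness n v)) \<longleftrightarrow>
      (\<exists>W<?b ^ (n + 2). (\<forall>k<n + 1. adjacent C (digit ?b W k) (digit ?b W (Suc k))) \<and> witness n (digit ?b W))"
      for n
    proof (rule ex_digits_iff[OF b])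
      fix v w :: "nat \<Rightarrow> nat"
      assume eq: "\<forall>k<n + 2. v k = w k"
      show "(\<forall>k<n + 1. adjacent C (v k) (v (Suc k))) \<and> witness n v \<Longrightarrow>
          (\<forall>k<n + 1. adjacent C (w k) (w (Suc k))) \<and> witness n w"
        using eq witness_cong[OF eq] by simp
    qed
    then show ?thesis by simp
  qed
  also have "\<dots> \<longleftrightarrow> PPT_search g C x y z e"
  proof -
    \<comment> \<open>The pattern has \<open>n + 2\<close> cells, each contributing a denominator
      \<open>?R\<close>.\<close>
    have weight: "weight_fun n (digit ?b W) = real (walk_hits C x y z n W) / real (?R ^ (n + 2))" for n W
      by (simp add: weight_fun_def walk_hits_def prod_dividef)
    have pos: "0 < weight_fun n (digit ?b W) \<longleftrightarrow> 0 < walk_hits C x y z n W" for n W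
      unfolding weight using R by (simp add: zero_less_divide_iff del: of_nat_power)
    have cycle: "(\<Prod>k<l. hit_prob (u k) y) = real (\<Prod>k<l. hits C (u k) y) / real (?R ^ l)" for l and u :: "nat \<Rightarrow> nat"
      by (simp add: prod_dividef)
    have "witness n (digit ?b W) \<longleftrightarrow>
        (g [e, 1, n, walk_hits C x y z n W, num_symbols C ^ (n + 2)] = 1 \<or>
         0 < walk_hits C x y z n W \<and>
         (\<exists>j<n + 1. \<exists>i<j. adjacent C (digit ?b W j) (digit ?b W (Suc i)) \<and>
            g [e, 0, j - i, \<Prod>k<j - i. hits C (digit ?b W (Suc (i + k))) y, num_symbols C ^ (j - i)] = 1))"
      for n W
      unfolding witness_def pos unfolding weight cycle num_symbols_encode using R by (simp only: g0 g1 zero_less_power)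
    then show ?thesis unfolding PPT_search_def by simp
  qed
  finally show ?thesis .
qed

end

theorem theorem6p5:
  fixes N :: "nat set" and \<alpha> lam :: "nat \<Rightarrow> real"
  assumes "\<And>e. e \<in> N \<Longrightarrow> \<alpha> e > 0"
    and "\<And>e. e \<in> N \<Longrightarrow> lam e < 1"
    and "\<And>e n. e \<in> N \<Longrightarrow> n \<ge> 1 \<Longrightarrow> \<alpha> e * lam e ^ n \<in> {0..1}"
    and "effective_thresholds N \<alpha> lam"
  shows "decidable_problem 5
           {[encode_ca A, x, y, z, e] | A x y z e.
              PPT_input A x y z \<and> is_cfca A \<and> e \<in> N}
           {[encode_ca A, x, y, z, e] | A x y z e.
              PPT_input A x y z \<and> is_cfca A \<and> e \<in> N \<and>
              PPT A x y z (\<lambda>n. \<alpha> e * lam e ^ n)}"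
proof -
  obtain g where g: "recursive_fn 5 g"
    "\<And>e i n p q. e \<in> N \<Longrightarrow> i \<le> 1 \<Longrightarrow> 0 < q \<Longrightarrow>
       g [e, i, n, p, q] = (if \<alpha> e ^ i * lam e ^ n < real p / real q then 1 else 0)"
    using assms(4) unfolding effective_thresholds_def decidable_problem_def by fastforce
  obtain f where f: "recursive_fn 5 f" "\<And>xs. length xs = 5 \<Longrightarrow>
      of_bool (PPT_search g (xs!0) (xs!1) (xs!2) (xs!3) (xs!4)) = f xs"
    using tot_rec_PPT_search[OF g(1)] unfolding tot_rec_def by blast
  have search: "PPT A x y z (\<lambda>n. \<alpha> e * lam e ^ n) \<longleftrightarrow> PPT_search g (encode_ca A) x y z e"
    if "PPT_input A x y z" "is_cfca A" "e \<in> N" for A x y z e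
  proof -
    interpret encoded_cfca A by unfold_locales (rule that)
    \<comment> \<open>The threshold at \<open>n = 1\<close> is nonnegative and \<alpha> is
      positive.\<close>
    have "0 \<le> lam e"
      using assms(1)[OF that(3)] assms(3)[OF that(3), of 1] by (simp add: zero_le_mult_iff)
    then show ?thesis
      using that assms(1)[OF that(3)] by (intro PPT_iff_search) (auto simp: PPT_input_def g(2))
  qed
  show ?thesis
    unfolding decidable_problem_def
  proof (intro exI[of _ f] conjI ballI f(1))
    fix xs
    assume "xs \<in> {[encode_ca A, x, y, z, e] | A x y z e. PPT_input A x y z \<and> is_cfca A \<and> e \<in> N}"
    then obtain A x y z e where xs: "xs = [encode_ca A, x, y, z, e]"
      and I: "PPT_input A x y z" "is_cfca A" "e \<in> N" by blast
    then show "length xs = 5" by simp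
    have "xs \<in> {[encode_ca A, x, y, z, e] | A x y z e.
        PPT_input A x y z \<and> is_cfca A \<and> e \<in> N \<and> PPT A x y z (\<lambda>n. \<alpha> e * lam e ^ n)} \<longleftrightarrow>
      PPT_search g (encode_ca A) x y z e"
      unfolding xs mem_Collect_eq
    proof
      \<comment> \<open>A positive instance may come from another automaton with the same code; the
        search sees only the code, so its answer is the same for both.\<close>
      assume "\<exists>A' x' y' z' e'. [encode_ca A, x, y, z, e] = [encode_ca A', x', y', z', e'] \<and>
        PPT_input A' x' y' z' \<and> is_cfca A' \<and> e' \<in> N \<and> PPT A' x' y' z' (\<lambda>n. \<alpha> e' * lam e' ^ n)"
      then obtain A' where "encode_ca A = encode_ca A'" "PPT_input A' x y z" "is_cfca A'"
        "PPT A' x y z (\<lambda>n. \<alpha> e * lam e ^ n)"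
        by (auto simp only: list.inject)
      then show "PPT_search g (encode_ca A) x y z e" using search[of A' x y z e] I by simp
    qed (use I search[OF I] in blast)
    moreover have "f xs = of_bool (PPT_search g (encode_ca A) x y z e)"
      using f(2)[of xs] by (simp add: xs)
    ultimately show "f xs = (if xs \<in> {[encode_ca A, x, y, z, e] | A x y z e.
        PPT_input A x y z \<and> is_cfca A \<and> e \<in> N \<and> PPT A x y z (\<lambda>n. \<alpha> e * lam e ^ n)} then 1 else 0)"
      by (simp only: of_bool_def)
  qed
qed

end
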